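(* Let $X$ be an infinite-dimensional complex Banach space and let $T\in\mathcal{B}(X)$ be a bounded linear operator. Then for every $\varepsilon>0$ there exists $F\in\mathcal{B}(X)$ of rank at most one with $\|F\|\leq\varepsilon$ such that $T+F$ has an invariant half-space, i.e. there is a half-space $Y$ of $X$ with $(T+F)Y\subseteq Y$.
   Context: $\mathcal{B}(X)$ denotes the algebra of all bounded linear operators on $X$. A half-space of $X$ is a closed linear subspace $Y\subseteq X$ such that both $\dim Y=\infty$ and $\dim(X/Y)=\infty$. *)

theory Defs
  imports "HOL-Analysis.Analysis" "HOL-Library.Set_Algebras"
begin

section \<open>Complex Banach spaces\<close>

text \<open>The classes refine the real ones, so the topology, completeness and the operator norm are
  those of the library; the complex scalar multiplication has to extend the real one.\<close>

class complex_vector = real_vector +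
  fixes scaleC :: "complex \<Rightarrow> 'a \<Rightarrow> 'a" (infixr \<open>*\<^sub>C\<close> 75)
  assumes scaleC_add_right: "a *\<^sub>C (x + y) = a *\<^sub>C x + a *\<^sub>C y"
    and scaleC_add_left: "(a + b) *\<^sub>C x = a *\<^sub>C x + b *\<^sub>C x"
    and scaleC_scaleC: "a *\<^sub>C b *\<^sub>C x = (a * b) *\<^sub>C x"
    and scaleC_of_real: "complex_of_real r *\<^sub>C x = r *\<^sub>R x"

class complex_normed_vector = complex_vector + real_normed_vector +
  assumes norm_scaleC [simp]: "norm (a *\<^sub>C x) = cmod a * norm x"

class complex_banach = complex_normed_vector + banach

instantiation complex :: complex_banach
begin

definition scaleC_complex_def [simp]: "a *\<^sub>C (x::complex) = a * x"

instance
  by standard (simp_all add: algebra_simps norm_mult scaleR_conv_of_real)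

end

global_interpretation complex_vector: vector_space "scaleC :: complex \<Rightarrow> 'a \<Rightarrow> 'a::complex_vector"
  defines csubspace = complex_vector.subspace
    and cspan = complex_vector.span
    and cdependent = complex_vector.dependent
    and crepresentation = complex_vector.representation
    and cextend_basis = complex_vector.extend_basis
    and cdim = complex_vector.dim
proof unfold_locales
  show "1 *\<^sub>C x = x" for x :: 'a
    using scaleC_of_real[of 1 x] by simp
qed (simp_all add: scaleC_add_right scaleC_add_left scaleC_scaleC)


section \<open>Dimension of subspaces and of quotients\<close>

text \<open>Needed besides \<^const>\<open>cdim\<close>, which is a natural number and equals 0
  on infinite-dimensional spaces.\<close>

definition finite_cdim :: "'a::complex_vector set \<Rightarrow> bool"
  where "finite_cdim V \<longleftrightarrow> (\<exists>B. finite B \<and> cspan B = V)"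

abbreviation infinite_cdim :: "'a::complex_vector set \<Rightarrow> bool"
  where "infinite_cdim V \<equiv> \<not> finite_cdim V"

text \<open>For a subspace \<open>Y\<close>, the elements of the quotient \<open>X/Y\<close> are the cosets \<open>x + Y\<close>. Their sum is the
  elementwise sum of sets, and the zero vector is \<open>Y\<close>. In the scalar multiple, the summand \<open>Y\<close>
  matters only for the scalar \<open>0\<close>, where it turns \<open>{0}\<close> into \<open>Y\<close>.\<close>

definition quotient_space :: "'a::complex_vector set \<Rightarrow> 'a set set"
  where "quotient_space Y = range (\<lambda>x. x +o Y)"

definition quotient_scale :: "'a::complex_vector set \<Rightarrow> complex \<Rightarrow> 'a set \<Rightarrow> 'a set"
  where "quotient_scale Y c A = scaleC c ` A + Y"

inductive_set quotient_span :: "'a::complex_vector set \<Rightarrow> 'a set set \<Rightarrow> 'a set set"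
  for Y :: "'a set" and S :: "'a set set" where
  zero: "Y \<in> quotient_span Y S"
| step: "A \<in> S \<Longrightarrow> B \<in> quotient_span Y S \<Longrightarrow> quotient_scale Y c A + B \<in> quotient_span Y S"

definition finite_quotient_cdim :: "'a::complex_vector set \<Rightarrow> bool"
  where "finite_quotient_cdim Y \<longleftrightarrow>
    (\<exists>S. finite S \<and> S \<subseteq> quotient_space Y \<and> quotient_span Y S = quotient_space Y)"

abbreviation infinite_quotient_cdim :: "'a::complex_vector set \<Rightarrow> bool"
  where "infinite_quotient_cdim Y \<equiv> \<not> finite_quotient_cdim Y"

definition half_space :: "'a::complex_normed_vector set \<Rightarrow> bool"
  where "half_space Y \<longleftrightarrow>
    csubspace Y \<and> closed Y \<and> infinite_cdim Y \<and> infinite_quotient_cdim Y"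

lemma add_cosets:
  assumes "csubspace Y"
  shows "(x +o Y) + (y +o Y) = (x + y) +o Y"
proof -
  have "Y + Y = Y"
    using complex_vector.subspace_add[OF assms] complex_vector.subspace_0[OF assms]
    by (force simp: set_plus_def)
  then show ?thesis
    by (simp add: set_plus_rearrange)
qed

lemma quotient_scale_coset:
  assumes "csubspace Y"
  shows "quotient_scale Y c (x +o Y) = (c *\<^sub>C x) +o Y"
proof (intro set_eqI iffI)
  fix z assume "z \<in> quotient_scale Y c (x +o Y)"
  then obtain u v where "u \<in> Y" "v \<in> Y" "z = c *\<^sub>C x + (c *\<^sub>C u + v)"
    by (auto simp: quotient_scale_def set_plus_def elt_set_plus_def scaleC_add_right add.assoc)
  then show "z \<in> (c *\<^sub>C x) +o Y"
    using complex_vector.subspace_add[OF assms] complex_vector.subspace_scale[OF assms]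
    by (auto simp: elt_set_plus_def)
next
  fix z assume "z \<in> (c *\<^sub>C x) +o Y"
  then obtain v where "v \<in> Y" "z = c *\<^sub>C x + v"
    by (auto simp: elt_set_plus_def)
  moreover have "x \<in> x +o Y"
    using complex_vector.subspace_0[OF assms] by (force simp: elt_set_plus_def)
  ultimately show "z \<in> quotient_scale Y c (x +o Y)"
    unfolding quotient_scale_def by (auto intro!: set_plus_intro)
qed

lemma quotient_span_cosets:
  assumes "csubspace Y"
  shows "quotient_span Y ((\<lambda>x. x +o Y) ` B) = (\<lambda>x. x +o Y) ` cspan B"
proof (intro equalityI subsetI)
  fix A assume "A \<in> quotient_span Y ((\<lambda>x. x +o Y) ` B)"
  then show "A \<in> (\<lambda>x. x +o Y) ` cspan B"
  proof induction
    case zero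
    show ?case
      using complex_vector.span_zero[of B] by (force simp: elt_set_plus_def)
  next
    case (step A C c)
    then obtain x y where "x \<in> B" "A = x +o Y" "y \<in> cspan B" "C = y +o Y"
      by auto
    moreover from this have "c *\<^sub>C x + y \<in> cspan B"
      by (simp add: complex_vector.span_add complex_vector.span_scale complex_vector.span_base)
    ultimately show ?case
      by (simp add: quotient_scale_coset add_cosets assms)
  qed
next
  fix A assume "A \<in> (\<lambda>x. x +o Y) ` cspan B"
  then obtain x where "x \<in> cspan B" and A: "A = x +o Y"
    by auto
  from this(1) have "x +o Y \<in> quotient_span Y ((\<lambda>x. x +o Y) ` B)"
  proof (induction rule: complex_vector.span_induct_alt)
    case base
    show ?case
      using quotient_span.zero by (simp add: elt_set_plus_def)
  next
    case (step c x y)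
    then have "quotient_scale Y c (x +o Y) + (y +o Y) \<in> quotient_span Y ((\<lambda>x. x +o Y) ` B)"
      by (intro quotient_span.step) auto
    then show ?case
      by (simp add: quotient_scale_coset add_cosets assms)
  qed
  then show "A \<in> quotient_span Y ((\<lambda>x. x +o Y) ` B)"
    by (simp add: A)
qed


section \<open>Bounded operators\<close>

text \<open>The library type \<open>'a \<Rightarrow>\<^sub>L 'a\<close> consists of the bounded \<^emph>\<open>real\<close>-linear maps; \<open>B(X)\<close> is the
  set of complex-linear ones among them, with the operator norm and addition of that type.\<close>

definition bounded_operators :: "('a::complex_normed_vector \<Rightarrow>\<^sub>L 'a) set"
  where "bounded_operators =
    {T. Vector_Spaces.linear scaleC scaleC (blinfun_apply T)}"

definition rank_at_most :: "nat \<Rightarrow> ('a::complex_normed_vector \<Rightarrow>\<^sub>L 'a) \<Rightarrow> bool"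
  where "rank_at_most n F \<longleftrightarrow>
    finite_cdim (range (blinfun_apply F)) \<and> cdim (range (blinfun_apply F)) \<le> n"

end

theory Submission
  imports Defs "HOL-Complex_Analysis.Conformal_Mappings"
begin

text \<open>
  If \<open>f\<close> is a bounded functional with \<open>f ((\<zeta> - T)\<^sup>-\<^sup>1 e) = 1\<close>, then \<open>\<zeta>\<close> is an eigenvalue both of
  \<open>T + f \<otimes> e\<close> and of its adjoint, with eigenvector \<open>(\<zeta> - T)\<^sup>-\<^sup>1 e\<close> and eigenfunctional
  \<open>f \<circ> (\<zeta> - T)\<^sup>-\<^sup>1\<close>. If there are infinitely many such \<open>\<zeta>\<close>, then the common kernel of every second
  eigenfunctional is an invariant half-space, because it contains the remaining eigenvectors.

  Suppose that all small \<open>e\<close> and \<open>f\<close> admit only finitely many solutions, and let \<open>\<zeta>\<^sub>0\<close> be a boundary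
  point of the spectrum. By Baire's theorem there are balls around some \<open>e\<^sub>0\<close>, \<open>f\<^sub>0\<close> and \<open>\<zeta>\<^sub>0\<close> without
  any solution. Perturbing \<open>e\<^sub>0\<close> and \<open>f\<^sub>0\<close> simultaneously shows that \<open>g \<zeta> = f\<^sub>0 ((\<zeta> - T)\<^sup>-\<^sup>1 e\<^sub>0) - 1\<close>
  dominates a multiple of the norm of the resolvent, hence of the reciprocal distance to the spectrum.
  So \<open>1 / g\<^sup>2\<close>, extended by \<open>0\<close> to the spectrum, is holomorphic near \<open>\<zeta>\<^sub>0\<close>; its zero at \<open>\<zeta>\<^sub>0\<close> is isolated
  and of finite order, so \<open>\<zeta>\<^sub>0\<close> is a pole of the resolvent.
  If this happens at every boundary point, the spectrum is finite, and by Liouville's theorem \<open>T\<close> is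
  annihilated by a polynomial. Then some eigenspace is infinite-dimensional, and
  any half-space inside it is invariant under \<open>T\<close> itself.
\<close>

subsection \<open>Norming functionals\<close>

definition sublinear_functional :: "('a::real_normed_vector \<Rightarrow> real) \<Rightarrow> bool"
  where "sublinear_functional p \<longleftrightarrow>
    (\<forall>x y. p (x + y) \<le> p x + p y) \<and> (\<forall>t x. t \<ge> 0 \<longrightarrow> p (t *\<^sub>R x) = t * p x) \<and> (\<forall>x. p x \<le> norm x)"

text \<open>Domination by the norm at \<open>-x\<close> controls the value at \<open>x\<close> from
  below, which keeps pointwise infima of families of such functionals finite.\<close>

lemma sublinear_functional_lower_bound:
  assumes "sublinear_functional p"
  shows "- norm x \<le> p x"
proof -
  have "p 0 = 0"
    using assms unfolding sublinear_functional_def by (metis mult_zero_left order_refl scale_zero_left)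
  moreover have "p (x + (-x)) \<le> p x + p (-x)" "p (-x) \<le> norm (-x)"
    using assms unfolding sublinear_functional_def by blast+
  ultimately show ?thesis
    by simp
qed

text \<open>Using the inequality with the scalar \<open>1/t\<close> at the vector
  \<open>t *\<^sub>R x\<close> gives the reverse one.\<close>

lemma sublinear_functional_scaleR:
  fixes p :: "'a::real_normed_vector \<Rightarrow> real"
  assumes "\<And>t x. t > 0 \<Longrightarrow> p (t *\<^sub>R x) \<le> t * p x" and "p 0 = (0::real)" and "t \<ge> 0"
  shows "p (t *\<^sub>R x) = t * p x"
proof (cases "t = 0")
  case False
  then have t: "t > 0"
    using assms by simp
  have "p ((1/t) *\<^sub>R (t *\<^sub>R x)) \<le> (1/t) * p (t *\<^sub>R x)"
    using assms(1)[of "1/t" "t *\<^sub>R x"] t by simp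
  then have "t * p x \<le> p (t *\<^sub>R x)"
    using t by (simp add: pos_le_divide_eq mult.commute)
  then show ?thesis
    using assms(1)[OF t, of x] by simp
qed (use assms in simp)

text \<open>The shear lowers a sublinear functional: \<open>t = 0\<close> gives
  \<open>q \<le> p\<close>, and \<open>t = 1\<close> gives \<open>q x \<le> p (x + y) - p y\<close>.
  Hence a minimal \<open>p\<close> is additive.\<close>

lemma sublinear_functional_shear:
  fixes y :: "'a::real_normed_vector"
  assumes p: "sublinear_functional p"
  defines "q \<equiv> \<lambda>x. INF t\<in>{0..}. p (x + t *\<^sub>R y) - t * p y"
  shows "sublinear_functional q" and "t \<ge> 0 \<Longrightarrow> q x \<le> p (x + t *\<^sub>R y) - t * p y"
proof -
  have padd: "p (x + z) \<le> p x + p z" and pscale: "s \<ge> 0 \<Longrightarrow> p (s *\<^sub>R x) = s * p x"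
    and pn: "p x \<le> norm x" for x z s
    using p unfolding sublinear_functional_def by blast+
  have lb: "- norm x \<le> p (x + t *\<^sub>R y) - t * p y" if "t \<ge> 0" for t x
  proof -
    have "t * p y = p ((x + t *\<^sub>R y) + (-x))"
      using that by (simp add: pscale)
    also have "\<dots> \<le> p (x + t *\<^sub>R y) + p (-x)"
      by (rule padd)
    finally show ?thesis
      using pn[of "-x"] by simp
  qed
  have bdd: "bdd_below ((\<lambda>t. p (x + t *\<^sub>R y) - t * p y) ` {0..})" for x
    using lb[of _ x] by (intro bdd_belowI2) auto
  have qle: "q x \<le> p (x + t *\<^sub>R y) - t * p y" if "t \<ge> 0" for t x
    unfolding q_def using that by (intro cINF_lower bdd) auto
  then show "t \<ge> 0 \<Longrightarrow> q x \<le> p (x + t *\<^sub>R y) - t * p y" .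
  have qge: "c \<le> q x" if "\<And>t. t \<ge> 0 \<Longrightarrow> c \<le> p (x + t *\<^sub>R y) - t * p y" for c x
    unfolding q_def using that by (intro cINF_greatest) auto
  have "q x + q z \<ge> q (x + z)" for x z
  proof -
    \<comment> \<open>Parameters \<open>t\<close> for \<open>x\<close> and \<open>s\<close> for
      \<open>z\<close> combine to the single parameter \<open>t + s\<close> for
      \<open>x + z\<close>.\<close>
    have "q (x + z) - (p (z + s *\<^sub>R y) - s * p y) \<le> q x" if s: "s \<ge> 0" for s
    proof (rule qge)
      fix t :: real assume t: "t \<ge> 0"
      have "q (x + z) \<le> p ((x + z) + (t + s) *\<^sub>R y) - (t + s) * p y"
        using s t by (intro qle) auto
      also have "(x + z) + (t + s) *\<^sub>R y = (x + t *\<^sub>R y) + (z + s *\<^sub>R y)"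
        by (simp add: algebra_simps)
      also have "p \<dots> \<le> p (x + t *\<^sub>R y) + p (z + s *\<^sub>R y)"
        by (rule padd)
      finally show "q (x + z) - (p (z + s *\<^sub>R y) - s * p y) \<le> p (x + t *\<^sub>R y) - t * p y"
        by (simp add: algebra_simps)
    qed
    then have "q (x + z) - q x \<le> q z"
      by (intro qge) (simp add: algebra_simps)
    then show ?thesis by simp
  qed
  moreover have "q (s *\<^sub>R x) = s * q x" if "s \<ge> 0" for s x
  proof (rule sublinear_functional_scaleR[OF _ _ that])
    have "p 0 = 0" using pscale[of 0 0] by simp
    then show "q 0 = 0"
      using qle[of 0 0] qge[of 0 0] pscale by fastforce
  next
    fix s :: real and x assume s: "s > 0"
    have "q (s *\<^sub>R x) / s \<le> q x"
    proof (rule qge)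
      fix t :: real assume t: "t \<ge> 0"
      have "q (s *\<^sub>R x) \<le> p (s *\<^sub>R x + (s * t) *\<^sub>R y) - s * t * p y"
        using s t by (intro qle) auto
      also have "s *\<^sub>R x + (s * t) *\<^sub>R y = s *\<^sub>R (x + t *\<^sub>R y)"
        by (simp add: algebra_simps)
      also have "p \<dots> = s * p (x + t *\<^sub>R y)"
        using s by (simp add: pscale)
      finally show "q (s *\<^sub>R x) / s \<le> p (x + t *\<^sub>R y) - t * p y"
        using s by (simp add: field_simps)
    qed
    then show "q (s *\<^sub>R x) \<le> s * q x"
      using s by (simp add: field_simps)
  qed
  moreover have "q x \<le> norm x" for x
    using qle[of 0 x] pn[of x] by simp
  ultimately show "sublinear_functional q"
    unfolding sublinear_functional_def by blast
qed

text \<open>Subadditivity is where the chain condition enters: members chosen separately for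
  \<open>x\<close> and for \<open>z\<close> have a common lower one in the chain.\<close>

lemma sublinear_functional_Inf_chain:
  fixes C :: "('a::real_normed_vector \<Rightarrow> real) set"
  assumes C: "\<And>p. p \<in> C \<Longrightarrow> sublinear_functional p" and ne: "C \<noteq> {}"
    and chain: "\<And>p q. p \<in> C \<Longrightarrow> q \<in> C \<Longrightarrow> p \<le> q \<or> q \<le> p"
  shows "sublinear_functional (\<lambda>x. INF p\<in>C. p x)"
    and "p \<in> C \<Longrightarrow> (INF p\<in>C. p x) \<le> p x"
proof -
  have bdd: "bdd_below ((\<lambda>p. p x) ` C)" for x
    using C sublinear_functional_lower_bound by (intro bdd_belowI2) auto
  define q where "q x = (INF p\<in>C. p x)" for x
  have qle: "q x \<le> p x" if "p \<in> C" for p x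
    unfolding q_def using that by (intro cINF_lower bdd)
  then show "p \<in> C \<Longrightarrow> (INF p\<in>C. p x) \<le> p x"
    by (simp add: q_def)
  have qge: "c \<le> q x" if "\<And>p. p \<in> C \<Longrightarrow> c \<le> p x" for c x
    unfolding q_def using that by (intro cINF_greatest ne)
  have "q (x + z) \<le> q x + q z" for x z
  proof -
    have "q (x + z) - p z \<le> q x" if p: "p \<in> C" for p
    proof (rule qge)
      fix r assume r: "r \<in> C"
      obtain s where s: "s \<in> C" "s \<le> p" "s \<le> r"
        using chain[OF p r] p r by blast
      have "q (x + z) \<le> s (x + z)"
        using s by (intro qle)
      also have "\<dots> \<le> s x + s z"
        using C[OF s(1)] unfolding sublinear_functional_def by blast
      also have "\<dots> \<le> r x + p z"
        using s by (intro add_mono) (auto simp: le_fun_def)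
      finally show "q (x + z) - p z \<le> r x" by simp
    qed
    then have "q (x + z) - q x \<le> q z"
      by (intro qge) (simp add: algebra_simps)
    then show ?thesis by simp
  qed
  moreover have "q (t *\<^sub>R x) = t * q x" if "t \<ge> 0" for t x
  proof (rule sublinear_functional_scaleR[OF _ _ that])
    have "p 0 = 0" if "p \<in> C" for p
      using C[OF that] unfolding sublinear_functional_def by (metis mult_zero_left order_refl scale_zero_left)
    then have "(\<lambda>p. p 0) ` C = {0}"
      using ne by force
    then show "q 0 = 0"
      by (simp add: q_def)
  next
    fix s :: real and x :: 'a assume s: "s > 0"
    have "q (s *\<^sub>R x) / s \<le> q x"
    proof (rule qge)
      fix p assume p: "p \<in> C"
      have "p (s *\<^sub>R x) = s * p x"
        using C[OF p] s unfolding sublinear_functional_def by simp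
      then show "q (s *\<^sub>R x) / s \<le> p x"
        using qle[OF p, of "s *\<^sub>R x"] s by (simp add: field_simps)
    qed
    then show "q (s *\<^sub>R x) \<le> s * q x"
      using s by (simp add: field_simps)
  qed
  moreover have "q x \<le> norm x" for x
  proof -
    obtain p where "p \<in> C" using ne by blast
    then show ?thesis
      using qle[of p x] C[of p] unfolding sublinear_functional_def by (meson order_trans)
  qed
  ultimately show "sublinear_functional (\<lambda>x. INF p\<in>C. p x)"
    unfolding sublinear_functional_def q_def by blast
qed

text \<open>Minimal sublinear functionals are linear, so Zorn's lemma yields Hahn--Banach without
  extending anything from a subspace.\<close>

lemma norming_real_functional:
  fixes x0 :: "'a::real_normed_vector"
  obtains f where "bounded_linear f" and "\<And>x. \<bar>f x\<bar> \<le> norm x" and "f x0 = norm x0"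
proof -
  have sn: "sublinear_functional (norm :: 'a \<Rightarrow> real)"
    by (simp add: sublinear_functional_def norm_triangle_ineq)
  \<comment> \<open>Shearing the norm along \<open>x0\<close> forces the value at
    \<open>- x0\<close> down to \<open>- norm x0\<close>. A linear functional below
    \<open>p0\<close> is then at least \<open>norm x0\<close> at \<open>x0\<close>.\<close>
  obtain p0 where p0: "sublinear_functional p0" and "p0 (- x0) \<le> norm (- x0 + 1 *\<^sub>R x0) - 1 * norm x0"
    using sublinear_functional_shear[OF sn, where y = x0] zero_le_one by blast
  then have p0': "p0 (- x0) \<le> - norm x0"
    by simp
  define A where "A = {p. sublinear_functional p \<and> p \<le> p0}"
  have "\<exists>m\<in>A. \<forall>a\<in>A. a \<le> m \<longrightarrow> a = m"
  \<comment> \<open>The order is reversed, so Zorn's lemma yields a minimal sublinear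
    functional.\<close>
  proof (rule predicate_Zorn[where P = "\<lambda>p q. q \<le> p"])
    show "partial_order_on A (relation_of (\<lambda>p q. q \<le> p) A)"
      by (rule partial_order_on_relation_ofI) auto
    fix C assume "C \<in> Chains (relation_of (\<lambda>p q. q \<le> p) A)"
    then have CA: "C \<subseteq> A" and chain: "\<And>p q. p \<in> C \<Longrightarrow> q \<in> C \<Longrightarrow> p \<le> q \<or> q \<le> p"
      unfolding Chains_def relation_of_def by blast+
    show "\<exists>u\<in>A. \<forall>a\<in>C. u \<le> a"
    proof (cases "C = {}")
      case True
      then show ?thesis
        using p0 by (auto simp: A_def)
    next
      case False
      have C: "\<And>p. p \<in> C \<Longrightarrow> sublinear_functional p"
        using CA by (auto simp: A_def)
      define u where "u = (\<lambda>x. INF p\<in>C. p x)"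
      have "sublinear_functional u" and ule: "\<And>p. p \<in> C \<Longrightarrow> u \<le> p"
        using sublinear_functional_Inf_chain[OF C False chain] by (auto simp: u_def le_fun_def)
      moreover have "u \<le> p0"
        using False CA ule by (force simp: A_def intro: order_trans)
      ultimately show ?thesis
        by (auto simp: A_def)
    qed
  qed
  then obtain m where m: "sublinear_functional m" "m \<le> p0"
    and min: "\<And>a. sublinear_functional a \<Longrightarrow> a \<le> m \<Longrightarrow> a = m"
    unfolding A_def by (auto intro: order_trans)
  have madd: "m (x + y) \<le> m x + m y" and mscale: "t \<ge> 0 \<Longrightarrow> m (t *\<^sub>R x) = t * m x"
    and mn: "m x \<le> norm x" for x y t
    using m unfolding sublinear_functional_def by blast+
  have add: "m (x + y) = m x + m y" for x y
  proof -
    define q where "q = (\<lambda>x. INF t\<in>{0..}. m (x + t *\<^sub>R y) - t * m y)"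
    note shear = sublinear_functional_shear[OF m(1), where y = y]
    have "q \<le> m"
    proof (rule le_funI)
      fix x show "q x \<le> m x" unfolding q_def using shear(2)[of 0 x] by simp
    qed
    then have "q = m"
      using min shear(1) by (simp add: q_def)
    moreover have "q x \<le> m (x + y) - m y"
      unfolding q_def using shear(2)[of 1 x] by simp
    ultimately have "m x \<le> m (x + y) - m y"
      by simp
    then show ?thesis
      using madd[of x y] by simp
  qed
  have neg: "m (- x) = - m x" for x
  proof -
    have "m 0 = 0" using mscale[of 0 0] by simp
    then show ?thesis using add[of x "-x"] by simp
  qed
  have scale: "m (t *\<^sub>R x) = t * m x" for t x
    using mscale[of t x] mscale[of "-t" x] neg[of "(-t) *\<^sub>R x"] by (cases "t \<ge> 0") simp_all
  have abs: "\<bar>m x\<bar> \<le> norm x" for x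
    using mn[of x] mn[of "-x"] neg[of x] by simp
  have "bounded_linear m"
    by (rule bounded_linear_intro[where K = 1]) (use add scale abs in auto)
  moreover have "m x0 = norm x0"
    using m(2) p0' mn[of x0] neg[of x0] by (smt (verit) le_funE)
  ultimately show ?thesis
    using that abs by blast
qed

text \<open>A subset of the library type of bounded real-linear maps, so that norm, metric and
  completeness are inherited from there.\<close>

definition complex_dual :: "('a::complex_normed_vector \<Rightarrow>\<^sub>L complex) set"
  where "complex_dual = {f. \<forall>c x. blinfun_apply f (c *\<^sub>C x) = c * blinfun_apply f x}"

lemma complex_dual_scaleC: "f \<in> complex_dual \<Longrightarrow> blinfun_apply f (c *\<^sub>C x) = c * blinfun_apply f x"
  by (simp add: complex_dual_def)

lemma scaleR_eq_scaleC: "r *\<^sub>R x = complex_of_real r *\<^sub>C x"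
  by (simp add: scaleC_of_real)

text \<open>A real functional h is the real part of the complex-linear functional sending x to h(x)
  - i h(ix). Adding the bounds for real and imaginary part gives the factor 2, which later constants
  absorb.\<close>

lemma almost_norming_functional:
  fixes x0 :: "'a::complex_normed_vector"
  obtains f where "f \<in> complex_dual" and "norm f \<le> 2" and "norm x0 \<le> cmod (blinfun_apply f x0)"
proof -
  obtain h where h: "bounded_linear h" "\<And>x. \<bar>h x\<bar> \<le> norm x" "h x0 = norm x0"
    using norming_real_functional by blast
  interpret h: bounded_linear h by fact
  define g where "g x = Complex (h x) (- h (\<i> *\<^sub>C x))" for x
  have bound: "cmod (g x) \<le> norm x * 2" for x
  proof -
    have "cmod (g x) \<le> \<bar>h x\<bar> + \<bar>h (\<i> *\<^sub>C x)\<bar>"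
      using cmod_le[of "g x"] by (simp add: g_def)
    also have "\<dots> \<le> norm x + norm (\<i> *\<^sub>C x)"
      by (intro add_mono h)
    finally show ?thesis by simp
  qed
  have bl: "bounded_linear g"
  proof (rule bounded_linear_intro[OF _ _ bound])
    show "g (x + y) = g x + g y" for x y
      by (simp add: g_def complex_eq_iff h.add scaleC_add_right)
    show "g (r *\<^sub>R x) = r *\<^sub>R g x" for r x
    proof -
      have "\<i> *\<^sub>C (r *\<^sub>R x) = r *\<^sub>R (\<i> *\<^sub>C x)"
        by (simp only: scaleR_eq_scaleC scaleC_scaleC mult.commute)
      then show ?thesis
        by (simp add: g_def complex_eq_iff h.scaleR)
    qed
  qed
  show ?thesis
  proof (rule that[of "Blinfun g"])
    have gS: "g (c *\<^sub>C x) = c * g x" for c x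
    proof -
      have c1: "complex_of_real (Re c) + complex_of_real (Im c) * \<i> = c"
        and c2: "complex_of_real (Re c) * \<i> - complex_of_real (Im c) = \<i> * c"
        by (simp_all add: complex_eq_iff)
      have e: "c *\<^sub>C x = Re c *\<^sub>R x + Im c *\<^sub>R (\<i> *\<^sub>C x)"
        and e': "\<i> *\<^sub>C (c *\<^sub>C x) = Re c *\<^sub>R (\<i> *\<^sub>C x) - Im c *\<^sub>R x"
        unfolding scaleR_eq_scaleC scaleC_scaleC
        by (simp_all add: c1 c2 flip: scaleC_add_left complex_vector.scale_left_diff_distrib)
      show ?thesis
        unfolding g_def e' unfolding e by (simp add: complex_eq_iff h.add h.diff h.scaleR)
    qed
    then show "Blinfun g \<in> complex_dual"
      by (simp add: complex_dual_def bounded_linear_Blinfun_apply[OF bl])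
    show "norm (Blinfun g) \<le> 2"
      using bound by (intro norm_blinfun_bound) (simp_all add: bounded_linear_Blinfun_apply[OF bl] mult.commute)
    have "norm x0 = \<bar>Re (g x0)\<bar>"
      by (simp add: g_def h)
    then show "norm x0 \<le> cmod (blinfun_apply (Blinfun g) x0)"
      using abs_Re_le_cmod[of "g x0"] by (simp add: bounded_linear_Blinfun_apply[OF bl])
  qed
qed

subsection \<open>Infinite dimension and codimension\<close>

abbreviation clinear :: "('a::complex_vector \<Rightarrow> 'b::complex_vector) \<Rightarrow> bool"
  where "clinear \<equiv> Vector_Spaces.linear scaleC scaleC"

lemma clinearI:
  assumes "\<And>x y. f (x + y) = f x + f y" and "\<And>c x. f (c *\<^sub>C x) = c *\<^sub>C f x"
  shows "clinear f"
  using assms by (intro Vector_Spaces.linear.intro complex_vector.vector_space_axioms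
      module_hom.intro complex_vector.module_axioms module_hom_axioms.intro)

lemma
  assumes "clinear f"
  shows clinear_add: "f (x + y) = f x + f y"
    and clinear_diff: "f (x - y) = f x - f y"
    and clinear_scaleC: "f (c *\<^sub>C x) = c *\<^sub>C f x"
    and clinear_sum: "f (sum g S) = (\<Sum>a\<in>S. f (g a))"
    and clinear_0: "f 0 = 0"
proof -
  interpret Vector_Spaces.linear scaleC scaleC f by fact
  show "f (x + y) = f x + f y" "f (x - y) = f x - f y" "f (c *\<^sub>C x) = c *\<^sub>C f x"
    "f (sum g S) = (\<Sum>a\<in>S. f (g a))" "f 0 = 0"
    by (simp_all add: add diff scale sum zero)
qed

section \<open>Independent sequences and triangular systems\<close>

lemma clinear_eq_0_on_cspan:
  assumes "clinear f" and "\<And>b. b \<in> B \<Longrightarrow> f b = 0" and "x \<in> cspan B"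
  shows "f x = 0"
  using assms(3)
proof (induction rule: complex_vector.span_induct_alt)
  case base
  show ?case by (rule clinear_0[OF assms(1)])
next
  case (step c x y)
  then show ?case by (simp add: clinear_add[OF assms(1)] clinear_scaleC[OF assms(1)] assms(2))
qed

text \<open>The vector outside the span of the others may depend on the finite index set, so the
  criterion covers both eigenvectors and triangular systems. In a nontrivial relation, every vector
  with a non-zero coefficient would lie in the span of the others.\<close>

lemma infinite_cdimI:
  fixes b :: "nat \<Rightarrow> 'a::complex_vector"
  assumes b: "\<And>S. finite S \<Longrightarrow> S \<noteq> {} \<Longrightarrow> \<exists>k\<in>S. b k \<notin> cspan (b ` (S - {k}))"
    and V: "range b \<subseteq> V"
  shows "infinite_cdim V"
proof
  assume "finite_cdim V"
  then obtain B where B: "finite B" "cspan B = V"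
    by (auto simp: finite_cdim_def)
  have "inj b"
  proof (rule injI, rule ccontr)
    fix i j assume "b i = b j" "i \<noteq> j"
    moreover have "{i, j} - {i} = {j}" "{i, j} - {j} = {i}"
      using \<open>i \<noteq> j\<close> by auto
    ultimately show False
      using b[of "{i, j}"] by (simp add: complex_vector.span_base)
  qed
  then have "infinite (range b)"
    by (simp add: finite_image_iff)
  moreover have "\<not> cdependent (range b)"
  proof
    assume "cdependent (range b)"
    then obtain U u where U: "finite U" "U \<subseteq> range b" "(\<Sum>v\<in>U. u v *\<^sub>C v) = 0" "\<exists>v\<in>U. u v \<noteq> 0"
      unfolding complex_vector.dependent_explicit by blast
    \<comment> \<open>Zero coefficients are discarded: the hypothesis decides which index is singled
      out, and its coefficient has to be invertible.\<close>
    define W where "W = {v \<in> U. u v \<noteq> 0}"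
    define S where "S = b -` W"
    have bS: "b ` S = W"
      using U by (auto simp: S_def W_def)
    have "finite S"
      unfolding S_def using U by (intro finite_vimageI \<open>inj b\<close>) (simp add: W_def)
    moreover have "S \<noteq> {}"
      using bS U(4) by (auto simp: W_def)
    ultimately obtain k where k: "k \<in> S" "b k \<notin> cspan (b ` (S - {k}))"
      using b by blast
    have bSk: "b ` (S - {k}) = W - {b k}"
      using \<open>inj b\<close> bS by (auto simp: inj_def)
    have kW: "b k \<in> W"
      using k bS by blast
    have W0: "(\<Sum>v\<in>W. u v *\<^sub>C v) = 0"
      unfolding U(3)[symmetric] by (rule sum.mono_neutral_left) (use U in \<open>auto simp: W_def\<close>)
    have "u (b k) *\<^sub>C b k + (\<Sum>v\<in>W - {b k}. u v *\<^sub>C v) = 0"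
      using W0 sum.remove[OF _ kW, of "\<lambda>v. u v *\<^sub>C v"] U by (simp add: W_def)
    then have "u (b k) *\<^sub>C b k = - (\<Sum>v\<in>W - {b k}. u v *\<^sub>C v)"
      by (simp add: eq_neg_iff_add_eq_0)
    moreover have "- (\<Sum>v\<in>W - {b k}. u v *\<^sub>C v) \<in> cspan (b ` (S - {k}))"
      unfolding bSk by (intro complex_vector.span_neg complex_vector.span_sum
          complex_vector.span_scale complex_vector.span_base)
    ultimately have "u (b k) *\<^sub>C b k \<in> cspan (b ` (S - {k}))"
      by (simp only:)
    then have "(1 / u (b k)) *\<^sub>C (u (b k) *\<^sub>C b k) \<in> cspan (b ` (S - {k}))"
      by (rule complex_vector.span_scale)
    then show False
      using k kW by (simp add: scaleC_scaleC W_def)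
  qed
  moreover have "range b \<subseteq> cspan B"
    using V B by simp
  ultimately show False
    using complex_vector.independent_span_bound[OF B(1)] by blast
qed

text \<open>Induction on the other indices: \<open>A - \<mu> j\<close> kills \<open>h j\<close>,
  preserves the span of the remaining vectors and multiplies \<open>h k\<close> by the non-zero
  number \<open>\<mu> k - \<mu> j\<close>.\<close>

lemma infinite_cdim_eigenvectors:
  fixes h :: "nat \<Rightarrow> 'a::complex_vector"
  assumes A: "clinear A" and eig: "\<And>n. A (h n) = \<mu> n *\<^sub>C h n" and "inj \<mu>"
    and nz: "\<And>n. h n \<noteq> 0" and V: "range h \<subseteq> V"
  shows "infinite_cdim V"
proof (rule infinite_cdimI[OF _ V])
  have notin: "h k \<notin> cspan (h ` F)" if "finite F" "k \<notin> F" for F k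
    using that
  proof (induction F rule: finite_induct)
    case empty
    then show ?case using nz by simp
  next
    case (insert j F)
    define D where "D x = A x - \<mu> j *\<^sub>C x" for x
    have D: "clinear D"
      by (rule clinearI) (simp_all add: D_def clinear_add[OF A] clinear_scaleC[OF A] scaleC_add_right
          complex_vector.scale_right_diff_distrib scaleC_scaleC mult.commute)
    have Dh: "D (h i) = (\<mu> i - \<mu> j) *\<^sub>C h i" for i
      by (simp add: D_def eig complex_vector.scale_left_diff_distrib)
    have Dspan: "D x \<in> cspan (h ` F)" if "x \<in> cspan (h ` F)" for x
      using that
    proof (induction rule: complex_vector.span_induct_alt)
      case base
      show ?case by (simp add: clinear_0[OF D] complex_vector.span_zero)
    next
      case (step c x y)
      then obtain i where "i \<in> F" "x = h i" by auto
      then show ?case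
        using step by (simp add: clinear_add[OF D] clinear_scaleC[OF D] Dh
            complex_vector.span_add complex_vector.span_scale complex_vector.span_base)
    qed
    show ?case
    proof
      assume "h k \<in> cspan (h ` insert j F)"
      then obtain c where "h k - c *\<^sub>C h j \<in> cspan (h ` F)"
        using complex_vector.span_breakdown_eq[of "h k" "h j" "h ` F"] by auto
      then have "D (h k - c *\<^sub>C h j) \<in> cspan (h ` F)"
        by (rule Dspan)
      then have "(\<mu> k - \<mu> j) *\<^sub>C h k \<in> cspan (h ` F)"
        by (simp add: clinear_diff[OF D] clinear_scaleC[OF D] Dh)
      then have "(1 / (\<mu> k - \<mu> j)) *\<^sub>C ((\<mu> k - \<mu> j) *\<^sub>C h k) \<in> cspan (h ` F)"
        by (rule complex_vector.span_scale)
      moreover have "\<mu> k - \<mu> j \<noteq> 0"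
        using \<open>inj \<mu>\<close> insert.prems by (auto simp: inj_def)
      ultimately have "h k \<in> cspan (h ` F)"
        by (simp add: scaleC_scaleC)
      then show False
        using insert by simp
    qed
  qed
  fix S :: "nat set" assume "finite S" "S \<noteq> {}"
  then show "\<exists>k\<in>S. h k \<notin> cspan (h ` (S - {k}))"
    using notin[of "S - {k}" k for k] by auto
qed

text \<open>The functional with the least index in a finite set vanishes on all other vectors of the
  set, but not on its own.\<close>

lemma infinite_cdim_triangular:
  fixes b :: "nat \<Rightarrow> 'a::complex_vector" and \<phi> :: "nat \<Rightarrow> 'a \<Rightarrow> complex"
  assumes \<phi>: "\<And>n. clinear (\<phi> n)" and tri: "\<And>i n. i < n \<Longrightarrow> \<phi> i (b n) = 0"
    and diag: "\<And>n. \<phi> n (b n) \<noteq> 0" and V: "range b \<subseteq> V"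
  shows "infinite_cdim V"
proof (rule infinite_cdimI[OF _ V])
  fix S :: "nat set" assume S: "finite S" "S \<noteq> {}"
  define k where "k = Min S"
  have "\<phi> k x = 0" if "x \<in> cspan (b ` (S - {k}))" for x
  proof (rule clinear_eq_0_on_cspan[OF \<phi> _ that])
    fix y assume "y \<in> b ` (S - {k})"
    then obtain i where i: "i \<in> S" "i \<noteq> k" "y = b i"
      by auto
    then have "k < i"
      using S Min_le[of S i] by (metis k_def le_neq_implies_less)
    then show "\<phi> k y = 0"
      using tri i by simp
  qed
  then have "b k \<notin> cspan (b ` (S - {k}))"
    using diag by blast
  moreover have "k \<in> S"
    using S by (simp add: k_def)
  ultimately show "\<exists>k\<in>S. b k \<notin> cspan (b ` (S - {k}))"
    by blast
qed

text \<open>If finitely many cosets generated the quotient, each \<open>x n\<close> would be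
  congruent modulo \<open>Y\<close> to some \<open>b n\<close> from one finitely generated space.
  The functionals do not see the difference, so the \<open>b n\<close> would form a triangular
  system there.\<close>

lemma infinite_quotient_cdim_triangular:
  fixes x :: "nat \<Rightarrow> 'a::complex_vector" and \<phi> :: "nat \<Rightarrow> 'a \<Rightarrow> complex"
  assumes Y: "csubspace Y" and \<phi>: "\<And>n. clinear (\<phi> n)" and zero: "\<And>n y. y \<in> Y \<Longrightarrow> \<phi> n y = 0"
    and tri: "\<And>i n. i < n \<Longrightarrow> \<phi> i (x n) = 0" and diag: "\<And>n. \<phi> n (x n) \<noteq> 0"
  shows "infinite_quotient_cdim Y"
proof
  assume "finite_quotient_cdim Y"
  then obtain S where S: "finite S" "S \<subseteq> range (\<lambda>x. x +o Y)" "quotient_span Y S = range (\<lambda>x. x +o Y)"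
    unfolding finite_quotient_cdim_def quotient_space_def by blast
  obtain B where B: "finite B" "S = (\<lambda>x. x +o Y) ` B"
    using finite_subset_image[OF S(1,2)] by blast
  have "\<exists>b \<in> cspan B. \<exists>y \<in> Y. v = b + y" for v
  proof -
    have "v +o Y \<in> (\<lambda>x. x +o Y) ` cspan B"
      using S(3) unfolding B(2) quotient_span_cosets[OF Y] by blast
    then obtain b where "b \<in> cspan B" "v +o Y = b +o Y"
      by blast
    moreover have "v \<in> v +o Y"
      using complex_vector.subspace_0[OF Y] by (force simp: elt_set_plus_def)
    ultimately show ?thesis
      by (auto simp: elt_set_plus_def)
  qed
  then have "\<forall>n. \<exists>b y. b \<in> cspan B \<and> y \<in> Y \<and> x n = b + y"
    by blast
  then obtain b y where dec: "\<And>n. b n \<in> cspan B" "\<And>n. y n \<in> Y" "\<And>n. x n = b n + y n"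
    by metis
  have \<phi>b: "\<phi> i (b n) = \<phi> i (x n)" for i n
    using dec zero by (simp add: clinear_add[OF \<phi>])
  have "infinite_cdim (cspan B)"
    by (rule infinite_cdim_triangular[where b = b and \<phi> = \<phi>, OF \<phi>]) (use dec(1) in \<open>auto simp: \<phi>b tri diag\<close>)
  then show False
    using B by (auto simp: finite_cdim_def)
qed

section \<open>Half-spaces inside infinite-dimensional closed subspaces\<close>

lemma clinear_complex_dual:
  assumes "f \<in> complex_dual"
  shows "clinear (blinfun_apply f)"
  using assms by (intro clinearI) (simp_all add: blinfun.add_right complex_dual_scaleC)

text \<open>Vectors \<open>z n\<close> in \<open>Z\<close> and bounded functionals
  \<open>f n\<close> are built recursively as a biorthogonal system. The common kernel in
  \<open>Z\<close> of the even functionals contains the odd vectors, and the even vectors stay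
  independent modulo it.\<close>

lemma half_space_subset:
  fixes Z :: "'a::complex_normed_vector set"
  assumes Z: "csubspace Z" "closed Z" "infinite_cdim Z"
  obtains Y where "half_space Y" and "Y \<subseteq> Z"
proof -
  \<comment> \<open>\<open>P F n r\<close> says that the pair \<open>r\<close> of a vector and a
    functional extends the biorthogonal system \<open>F 0, ..., F (n - 1)\<close>.\<close>
  define P where "P F n r \<longleftrightarrow> fst r \<in> Z \<and> bounded_linear (snd r) \<and> clinear (snd r) \<and> snd r (fst r) = 1 \<and>
      (\<forall>i<n. snd (F i) (fst r) = 0 \<and> snd r (fst (F i)) = 0)"
    for F :: "nat \<Rightarrow> 'a \<times> ('a \<Rightarrow> complex)" and n and r :: "'a \<times> ('a \<Rightarrow> complex)"
  have "\<exists>F. \<forall>n. P F n (F n)"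
  proof (rule dependent_wellorder_choice)
    show "P f n r = P g n r" if "\<And>m. m < n \<Longrightarrow> f m = g m" for r f g n
      using that by (auto simp: P_def)
  next
    fix n :: nat and F
    assume F: "\<And>m. m < n \<Longrightarrow> P F m (F m)"
    define z where "z i = fst (F i)" for i
    define f where "f i = snd (F i)" for i
    have zZ: "z i \<in> Z" and bl: "bounded_linear (f i)" and cl: "clinear (f i)" and diag: "f i (z i) = 1" if "i < n" for i
      using F[OF that] by (auto simp: P_def z_def f_def)
    have bi: "f i (z j) = 0" if "i < n" "j < n" "i \<noteq> j" for i j
      using F[of i] F[of j] that by (cases "i < j") (auto simp: P_def z_def f_def)
    have biorth: "f i (z j) = (if i = j then 1 else 0)" if "i < n" "j < n" for i j
      using diag bi that by auto
    \<comment> \<open>Otherwise every vector of \<open>Z\<close> would equal its biorthogonal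
      expansion \<open>s\<close>, and finitely many \<open>z j\<close> would span
      \<open>Z\<close>.\<close>
    have "\<exists>w\<in>Z. w \<noteq> 0 \<and> (\<forall>i<n. f i w = 0)"
    proof (rule ccontr)
      assume no: "\<not> ?thesis"
      have "w \<in> cspan (z ` {..<n})" if w: "w \<in> Z" for w
      proof -
        define s where "s = (\<Sum>j<n. f j w *\<^sub>C z j)"
        have "s \<in> Z"
          unfolding s_def by (intro complex_vector.subspace_sum complex_vector.subspace_scale Z zZ) auto
        then have "w - s \<in> Z"
          using w Z by (intro complex_vector.subspace_diff)
        moreover have "f i (w - s) = 0" if i: "i < n" for i
        proof -
          have "f i s = (\<Sum>j<n. if i = j then f j w else 0)"
            unfolding s_def clinear_sum[OF cl[OF i]]
            by (intro sum.cong) (auto simp: clinear_scaleC[OF cl[OF i]] biorth i)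
          then show ?thesis
            using i by (simp add: clinear_diff[OF cl[OF i]])
        qed
        ultimately have "w = s"
          using no by auto
        moreover have "s \<in> cspan (z ` {..<n})"
          unfolding s_def by (intro complex_vector.span_sum complex_vector.span_scale complex_vector.span_base) simp
        ultimately show ?thesis
          by simp
      qed
      then have "cspan (z ` {..<n}) = Z"
        using complex_vector.span_minimal[OF _ Z(1), of "z ` {..<n}"] zZ by auto
      then show False
        using Z(3) by (auto simp: finite_cdim_def)
    qed
    then obtain w where w: "w \<in> Z" "w \<noteq> 0" "\<And>i. i < n \<Longrightarrow> f i w = 0"
      by blast
    obtain \<phi> where \<phi>: "\<phi> \<in> complex_dual" "norm w \<le> cmod (blinfun_apply \<phi> w)"
      using almost_norming_functional by metis
    have \<phi>w: "blinfun_apply \<phi> w \<noteq> 0"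
      using \<phi> w by auto
    \<comment> \<open>Subtracting the values at the earlier \<open>z j\<close> makes the functional
      vanish there. The correction is zero at \<open>w\<close>, so dividing by the value of
      \<open>\<phi>\<close> at \<open>w\<close> normalizes it.\<close>
    define g where "g x = (blinfun_apply \<phi> x - (\<Sum>j<n. blinfun_apply \<phi> (z j) * f j x)) * (1 / blinfun_apply \<phi> w)" for x
    have "P F n (w, g)"
      unfolding P_def fst_conv snd_conv
    proof (intro conjI allI impI)
      show "w \<in> Z" by fact
      show "bounded_linear g"
        unfolding g_def
        by (intro bounded_linear_mult_const bounded_linear_sub bounded_linear_sum
            bounded_linear_const_mult bl blinfun.bounded_linear_right) auto
      have c: "clinear (blinfun_apply \<phi>)"
        using \<phi>(1) by (rule clinear_complex_dual)
      show "clinear g"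
      proof (rule clinearI)
        have sa: "(\<Sum>j<n. blinfun_apply \<phi> (z j) * f j (x + y)) =
            (\<Sum>j<n. blinfun_apply \<phi> (z j) * f j x) + (\<Sum>j<n. blinfun_apply \<phi> (z j) * f j y)" for x y
          unfolding sum.distrib[symmetric] by (intro sum.cong) (simp_all add: clinear_add[OF cl] ring_distribs)
        show "g (x + y) = g x + g y" for x y
          unfolding g_def sa by (simp add: clinear_add[OF c] add_divide_distrib diff_divide_distrib)
        have sm: "(\<Sum>j<n. blinfun_apply \<phi> (z j) * f j (a *\<^sub>C x)) = a * (\<Sum>j<n. blinfun_apply \<phi> (z j) * f j x)" for a x
          unfolding sum_distrib_left by (intro sum.cong) (simp_all add: clinear_scaleC[OF cl])
        show "g (a *\<^sub>C x) = a *\<^sub>C g x" for a x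
          unfolding g_def sm by (simp add: clinear_scaleC[OF c] right_diff_distrib diff_divide_distrib)
      qed
      show "g w = 1"
        using \<phi>w w by (simp add: g_def)
      fix i assume i: "i < n"
      show "snd (F i) w = 0"
        using w i by (simp add: f_def)
      have "(\<Sum>j<n. blinfun_apply \<phi> (z j) * f j (z i)) = (\<Sum>j<n. if j = i then blinfun_apply \<phi> (z j) else 0)"
        by (intro sum.cong) (auto simp: biorth i)
      also have "\<dots> = blinfun_apply \<phi> (z i)"
        using i by simp
      finally show "g (fst (F i)) = 0"
        by (simp add: g_def flip: z_def)
    qed
    then show "\<exists>r. P F n r"
      by blast
  qed
  then obtain F where F: "\<And>n. P F n (F n)"
    by blast
  define z where "z i = fst (F i)" for i
  define f where "f i = snd (F i)" for i
  have zZ: "z i \<in> Z" and bl: "bounded_linear (f i)" and cl: "clinear (f i)" and diag: "f i (z i) = 1" for i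
    using F[of i] by (auto simp: P_def z_def f_def)
  have bi: "f i (z j) = 0" if "i \<noteq> j" for i j
    using F[of i] F[of j] that by (cases "i < j") (auto simp: P_def z_def f_def)
  define Y where "Y = Z \<inter> (\<Inter>n. {x. f (2 * n) x = 0})"
  have "csubspace Y"
    unfolding Y_def complex_vector.subspace_def using Z(1)
    by (auto simp: complex_vector.subspace_def clinear_0[OF cl] clinear_add[OF cl] clinear_scaleC[OF cl])
  moreover have "closed Y"
    unfolding Y_def using Z(2)
    by (intro closed_Int closed_INT ballI closed_Collect_eq continuous_on_const linear_continuous_on bl)
  moreover have odd_even_idx: "f (2 * m) (z (Suc (2 * n))) = 0" for m n
    by (rule bi) presburger
  have "infinite_cdim Y"
    by (intro infinite_cdim_triangular[where b = "\<lambda>n. z (2 * n + 1)" and \<phi> = "\<lambda>n. f (2 * n + 1)", OF cl])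
      (use zZ odd_even_idx bi in \<open>auto simp: diag Y_def\<close>)
  moreover have "infinite_quotient_cdim Y"
    by (rule infinite_quotient_cdim_triangular[where x = "\<lambda>n. z (2 * n)" and \<phi> = "\<lambda>n. f (2 * n)", OF \<open>csubspace Y\<close> cl])
      (auto simp: diag Y_def intro!: bi)
  ultimately show ?thesis
    using that[of Y] by (auto simp: half_space_def Y_def)
qed

section \<open>Finite-dimensional subspaces and preimages\<close>

lemma finite_cdim_subspace:
  assumes "csubspace V" and "V \<subseteq> cspan B" and "finite B"
  shows "finite_cdim V"
proof -
  obtain C where C: "C \<subseteq> V" "\<not> cdependent C" "V \<subseteq> cspan C"
    using complex_vector.maximal_independent_subset[of V] by blast
  then have "finite C"
    using complex_vector.independent_span_bound[OF assms(3)] assms(2) by blast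
  moreover have "cspan C = V"
    using C complex_vector.span_minimal[OF C(1) assms(1)] by blast
  ultimately show ?thesis
    by (auto simp: finite_cdim_def)
qed

text \<open>Generators of \<open>V \<inter> range A\<close> are lifted through \<open>A\<close>;
  together with generators of the kernel they span the preimage.\<close>

lemma finite_cdim_vimage:
  assumes A: "clinear A" and ker: "finite_cdim {x. A x = 0}" and V: "finite_cdim V"
  shows "finite_cdim {x. A x \<in> V}"
proof -
  interpret A: Vector_Spaces.linear scaleC scaleC A by fact
  obtain K where K: "finite K" "cspan K = {x. A x = 0}"
    using ker by (auto simp: finite_cdim_def)
  obtain B where B: "finite B" "cspan B = V"
    using V by (auto simp: finite_cdim_def)
  have subV: "csubspace V"
    using B complex_vector.subspace_span by blast
  have "csubspace (range A)"
    using A.subspace_image[of UNIV] by (simp add: csubspace_def module.subspace_UNIV[OF complex_vector.module_axioms])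
  then have "csubspace (V \<inter> range A)"
    by (rule complex_vector.subspace_inter[OF subV])
  then obtain B' where B': "finite B'" "cspan B' = V \<inter> range A"
    using finite_cdim_subspace[of "V \<inter> range A" B] B by (auto simp: finite_cdim_def)
  have "B' \<subseteq> range A"
    using B'(2) complex_vector.span_superset by blast
  then obtain C where C: "finite C" "B' = A ` C"
    using finite_subset_image[OF B'(1)] by blast
  show ?thesis
  proof (rule finite_cdim_subspace)
    show "csubspace {x. A x \<in> V}"
      using subV by (auto simp: complex_vector.subspace_def A.zero A.add A.scale)
    show "{x. A x \<in> V} \<subseteq> cspan (C \<union> K)"
    proof
      fix x assume "x \<in> {x. A x \<in> V}"
      then have "A x \<in> A ` cspan C"
        using B' C A.span_image[of C] by (auto simp: cspan_def)
      then obtain y where y: "y \<in> cspan C" "A x = A y"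
        by auto
      then have "x - y \<in> cspan K"
        using K by (simp add: A.diff)
      then have "y + (x - y) \<in> cspan (C \<union> K)"
        using y complex_vector.span_mono[of C "C \<union> K"] complex_vector.span_mono[of K "C \<union> K"]
        by (intro complex_vector.span_add) auto
      then show "x \<in> cspan (C \<union> K)"
        by simp
    qed
    show "finite (C \<union> K)"
      using C K by simp
  qed
qed

subsection \<open>Complex-analytic preliminaries\<close>

text \<open>An affine function without zeros in the disc of radius \<open>\<delta>\<close> has
  constant term at least \<open>\<delta>\<close> times its slope. This is used first in
  \<open>s\<close> with \<open>t = 0\<close>, then in \<open>t\<close> for an \<open>s\<close> at
  which the slope \<open>c + s * d\<close> is large.\<close>

lemma bilinear_avoids_0_imp_small:
  fixes a b c d :: complex
  assumes \<delta>: "\<delta> \<ge> 0"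
    and avoid: "\<And>s t. cmod s \<le> \<delta> \<Longrightarrow> cmod t \<le> \<delta> \<Longrightarrow> a + s * b + t * c + s * t * d \<noteq> 0"
  shows "\<delta>\<^sup>2 * cmod d \<le> 2 * cmod a"
proof -
  have linear: "\<delta> * cmod y \<le> cmod x" if "\<And>t. cmod t \<le> \<delta> \<Longrightarrow> x + t * y \<noteq> 0" for x y
  proof (rule ccontr)
    assume less: "\<not> \<delta> * cmod y \<le> cmod x"
    then have "y \<noteq> 0"
      by auto
    moreover from this less have "cmod (- (x / y)) \<le> \<delta>"
      by (simp add: norm_divide divide_le_eq)
    ultimately show False
      using that[of "- (x / y)"] by simp
  qed
  have b: "\<delta> * cmod b \<le> cmod a"
    by (rule linear) (use avoid[of _ 0] \<delta> in simp)
  \<comment> \<open>The values of \<open>c + s * d\<close> at \<open>s = \<delta>\<close> and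
    \<open>s = - \<delta>\<close> differ by \<open>2 * \<delta> * d\<close>, so they cannot both be
    small.\<close>
  have "\<exists>s. cmod s \<le> \<delta> \<and> \<delta> * cmod d \<le> cmod (c + s * d)"
  proof (rule ccontr)
    assume "\<not> ?thesis"
    then have small: "cmod (c + s * d) < \<delta> * cmod d" if "cmod s \<le> \<delta>" for s
      using that by (meson not_le)
    have "cmod (c + of_real \<delta> * d) < \<delta> * cmod d" "cmod (c + (- of_real \<delta>) * d) < \<delta> * cmod d"
      by (rule small, simp add: \<delta>)+
    moreover have "cmod ((c + of_real \<delta> * d) - (c + (- of_real \<delta>) * d)) = 2 * (\<delta> * cmod d)"
      using \<delta> by (simp add: norm_mult)
    ultimately show False
      using norm_triangle_ineq4[of "c + of_real \<delta> * d" "c + (- of_real \<delta>) * d"] by linarith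
  qed
  then obtain s where s: "cmod s \<le> \<delta>" "\<delta> * cmod d \<le> cmod (c + s * d)"
    by blast
  have "\<delta>\<^sup>2 * cmod d \<le> \<delta> * cmod (c + s * d)"
    using s \<delta> by (simp add: power2_eq_square mult_left_mono mult.assoc)
  also have "\<dots> \<le> cmod (a + s * b)"
    by (rule linear) (use avoid[OF s(1)] in \<open>simp add: algebra_simps\<close>)
  also have "\<dots> \<le> cmod a + cmod s * cmod b"
    using norm_triangle_ineq[of a "s * b"] by (simp add: norm_mult)
  also have "\<dots> \<le> 2 * cmod a"
    using b mult_right_mono[OF s(1), of "cmod b"] by simp
  finally show ?thesis .
qed

text \<open>Serves functions extended by 0 across the spectrum: a quadratic bound gives
  differentiability at a spectral point whatever the spectrum looks like nearby.\<close>

lemma has_field_derivative_0_if_quadratic: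
  fixes v :: "complex \<Rightarrow> complex"
  assumes "r > 0" and "v \<mu> = 0" and "\<And>w. w \<in> ball \<mu> r \<Longrightarrow> cmod (v w) \<le> C * (cmod (w - \<mu>))\<^sup>2"
  shows "(v has_field_derivative 0) (at \<mu>)"
  unfolding has_field_derivative_iff
proof (rule Lim_null_comparison)
  show "eventually (\<lambda>w. norm ((v w - v \<mu>) / (w - \<mu>)) \<le> C * cmod (w - \<mu>)) (at \<mu>)"
    unfolding eventually_at
  proof (intro exI[of _ r] conjI ballI impI)
    fix w assume "w \<noteq> \<mu> \<and> dist w \<mu> < r"
    then show "norm ((v w - v \<mu>) / (w - \<mu>)) \<le> C * cmod (w - \<mu>)"
      using assms(3)[of w]
      by (simp add: assms(2) norm_divide dist_commute divide_le_eq power2_eq_square mult.assoc)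
  qed (use assms in auto)
  show "((\<lambda>w. C * cmod (w - \<mu>)) \<longlongrightarrow> 0) (at \<mu>)"
    by (rule tendsto_eq_intros refl | simp)+
qed

subsection \<open>The resolvent\<close>

text \<open>As \<open>inv\<close> is total, the values are meaningful only where
  \<open>\<zeta> - T\<close> is bijective.\<close>

definition resolvent :: "('a::complex_normed_vector \<Rightarrow>\<^sub>L 'a) \<Rightarrow> complex \<Rightarrow> 'a \<Rightarrow> 'a"
  where "resolvent T \<zeta> = inv (\<lambda>x. \<zeta> *\<^sub>C x - blinfun_apply T x)"

text \<open>Invertibility is kept together with an explicit norm bound, because the growth of the
  admissible \<open>K\<close> near the spectrum drives the argument.\<close>

definition resolvent_bound :: "('a::complex_normed_vector \<Rightarrow>\<^sub>L 'a) \<Rightarrow> complex \<Rightarrow> real \<Rightarrow> bool"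
  where "resolvent_bound T \<zeta> K \<longleftrightarrow> bij (\<lambda>x. \<zeta> *\<^sub>C x - blinfun_apply T x) \<and> K > 0 \<and>
    (\<forall>x. norm (resolvent T \<zeta> x) \<le> K * norm x)"

text \<open>The spectrum appears throughout as \<open>- resolvent_set T\<close>.\<close>

definition resolvent_set :: "('a::complex_normed_vector \<Rightarrow>\<^sub>L 'a) \<Rightarrow> complex set"
  where "resolvent_set T = {\<zeta>. \<exists>K. resolvent_bound T \<zeta> K}"

text \<open>Takes the role of the Neumann series: perturbed linear equations are solved as
  fixed-point equations.\<close>

lemma ex1_fixpoint_contraction:
  fixes B :: "'a::banach \<Rightarrow> 'a"
  assumes "0 \<le> c" "c < 1" and "\<And>x y. norm (B x - B y) \<le> c * norm (x - y)"
  shows "\<exists>!y. B y = y"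
  by (rule banach_fix_type[OF assms(1,2)]) (simp add: assms(3) dist_norm)

lemma resolvent_boundI:
  assumes ex1: "\<And>x. \<exists>!y. \<zeta> *\<^sub>C y - blinfun_apply T y = x"
    and K: "K > 0" "\<And>y. norm y \<le> K * norm (\<zeta> *\<^sub>C y - blinfun_apply T y)"
  shows "resolvent_bound T \<zeta> K"
proof -
  have bij: "bij (\<lambda>x. \<zeta> *\<^sub>C x - blinfun_apply T x)"
    unfolding bij_iff by (rule allI) (rule ex1)
  then have "\<zeta> *\<^sub>C (resolvent T \<zeta> x) - blinfun_apply T (resolvent T \<zeta> x) = x" for x
    unfolding resolvent_def by (meson bij_inv_eq_iff)
  then show ?thesis
    using bij K by (metis resolvent_bound_def)
qed

lemma clinear_bounded_operator:
  "T \<in> bounded_operators \<Longrightarrow> clinear (blinfun_apply T)"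
  by (simp add: bounded_operators_def)

lemma resolvent_set_bij:
  "\<zeta> \<in> resolvent_set T \<Longrightarrow> bij (\<lambda>x. \<zeta> *\<^sub>C x - blinfun_apply T x)"
  by (auto simp: resolvent_set_def resolvent_bound_def)

lemma resolvent_right:
  "\<zeta> \<in> resolvent_set T \<Longrightarrow> \<zeta> *\<^sub>C (resolvent T \<zeta> x) - blinfun_apply T (resolvent T \<zeta> x) = x"
  unfolding resolvent_def by (rule surj_f_inv_f[OF bij_is_surj[OF resolvent_set_bij]])

lemma resolvent_left:
  "\<zeta> \<in> resolvent_set T \<Longrightarrow> resolvent T \<zeta> (\<zeta> *\<^sub>C x - blinfun_apply T x) = x"
  unfolding resolvent_def by (rule inv_f_f[OF bij_is_inj[OF resolvent_set_bij]])

lemma resolvent_0: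
  assumes "\<zeta> \<in> resolvent_set T"
  shows "resolvent T \<zeta> 0 = 0"
  using resolvent_left[OF assms, of 0] by simp

text \<open>A polynomial in \<open>T\<close> in factored form; the list holds its roots with
  multiplicity.\<close>

primrec shift_prod :: "('a::complex_normed_vector \<Rightarrow>\<^sub>L 'a) \<Rightarrow> complex list \<Rightarrow> 'a \<Rightarrow> 'a" where
  "shift_prod T [] x = x"
| "shift_prod T (a # as) x = blinfun_apply T (shift_prod T as x) - a *\<^sub>C shift_prod T as x"

text \<open>Expresses by growth that the resolvent has at \<open>\<zeta>\<close> an isolated
  singularity which is a pole of order at most \<open>n\<close>.\<close>

definition spectral_pole :: "('a::complex_normed_vector \<Rightarrow>\<^sub>L 'a) \<Rightarrow> complex \<Rightarrow> nat \<Rightarrow> bool"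
  where "spectral_pole T \<zeta> n \<longleftrightarrow> (\<exists>r K. r > 0 \<and> K > 0 \<and> (\<forall>w \<in> ball \<zeta> r - {\<zeta>}. w \<in> resolvent_set T \<and>
    (\<forall>x. cmod (w - \<zeta>) ^ n * norm (resolvent T w x) \<le> K * norm x)))"

context
  fixes T :: "'a::complex_banach \<Rightarrow>\<^sub>L 'a"
  assumes T: "T \<in> bounded_operators"
begin

lemmas clinear_T = clinear_bounded_operator[OF T]

lemma clinear_resolvent:
  assumes "\<zeta> \<in> resolvent_set T"
  shows "clinear (resolvent T \<zeta>)"
proof (rule clinearI)
  let ?R = "resolvent T \<zeta>"
  fix x y c
  have "\<zeta> *\<^sub>C (?R x + ?R y) - blinfun_apply T (?R x + ?R y) =
      (\<zeta> *\<^sub>C ?R x - blinfun_apply T (?R x)) + (\<zeta> *\<^sub>C ?R y - blinfun_apply T (?R y))"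
    by (simp add: clinear_add[OF clinear_T] scaleC_add_right)
  also have "\<dots> = x + y"
    by (simp add: resolvent_right[OF assms])
  finally show "?R (x + y) = ?R x + ?R y"
    using resolvent_left[OF assms] by metis
  have "\<zeta> *\<^sub>C (c *\<^sub>C ?R x) - blinfun_apply T (c *\<^sub>C ?R x) = c *\<^sub>C (\<zeta> *\<^sub>C ?R x - blinfun_apply T (?R x))"
    by (simp add: clinear_scaleC[OF clinear_T] complex_vector.scale_right_diff_distrib scaleC_scaleC mult.commute)
  also have "\<dots> = c *\<^sub>C x"
    by (simp add: resolvent_right[OF assms])
  finally show "?R (c *\<^sub>C x) = c *\<^sub>C ?R x"
    using resolvent_left[OF assms] by metis
qed

text \<open>Applying the resolvent at \<open>\<zeta>\<close> turns the equation at
  \<open>\<mu>\<close> into a fixed-point equation for \<open>y\<close>, with contraction factor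
  \<open>cmod (\<mu> - \<zeta>) * K\<close>. The same equation yields the new bound.\<close>

lemma resolvent_bound_perturb:
  assumes K: "resolvent_bound T \<zeta> K" and close: "cmod (\<mu> - \<zeta>) * K < 1"
  shows "resolvent_bound T \<mu> (K / (1 - cmod (\<mu> - \<zeta>) * K))"
proof (rule resolvent_boundI)
  have \<zeta>: "\<zeta> \<in> resolvent_set T" and K0: "K > 0" and R: "\<And>x. norm (resolvent T \<zeta> x) \<le> K * norm x"
    using K by (auto simp: resolvent_set_def resolvent_bound_def)
  have eq: "\<mu> *\<^sub>C y - blinfun_apply T y = x \<longleftrightarrow> resolvent T \<zeta> (x - (\<mu> - \<zeta>) *\<^sub>C y) = y" for x y
  proof -
    have "\<mu> *\<^sub>C y - blinfun_apply T y = x \<longleftrightarrow> \<zeta> *\<^sub>C y - blinfun_apply T y = x - (\<mu> - \<zeta>) *\<^sub>C y"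
      by (auto simp: complex_vector.scale_left_diff_distrib algebra_simps)
    also have "\<dots> \<longleftrightarrow> resolvent T \<zeta> (x - (\<mu> - \<zeta>) *\<^sub>C y) = y"
      using resolvent_left[OF \<zeta>] resolvent_right[OF \<zeta>] by metis
    finally show ?thesis .
  qed
  show "\<exists>!y. \<mu> *\<^sub>C y - blinfun_apply T y = x" for x
    unfolding eq
  proof (rule ex1_fixpoint_contraction)
    show "0 \<le> cmod (\<mu> - \<zeta>) * K" using K0 by simp
    fix y z
    have "resolvent T \<zeta> (x - (\<mu> - \<zeta>) *\<^sub>C y) - resolvent T \<zeta> (x - (\<mu> - \<zeta>) *\<^sub>C z)
        = resolvent T \<zeta> ((\<mu> - \<zeta>) *\<^sub>C (z - y))"
      unfolding clinear_diff[OF clinear_resolvent[OF \<zeta>], symmetric]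
      by (simp add: complex_vector.scale_right_diff_distrib)
    also have "norm \<dots> \<le> K * norm ((\<mu> - \<zeta>) *\<^sub>C (z - y))"
      by (rule R)
    finally show "norm (resolvent T \<zeta> (x - (\<mu> - \<zeta>) *\<^sub>C y) - resolvent T \<zeta> (x - (\<mu> - \<zeta>) *\<^sub>C z))
        \<le> cmod (\<mu> - \<zeta>) * K * norm (y - z)"
      by (simp add: norm_minus_commute mult_ac)
  qed fact
  show "0 < K / (1 - cmod (\<mu> - \<zeta>) * K)"
    using K0 close by simp
  fix y
  define x where "x = \<mu> *\<^sub>C y - blinfun_apply T y"
  have "norm y \<le> K * norm (x - (\<mu> - \<zeta>) *\<^sub>C y)"
    using R[of "x - (\<mu> - \<zeta>) *\<^sub>C y"] eq[of y x] by (simp add: x_def)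
  also have "\<dots> \<le> K * (norm x + cmod (\<mu> - \<zeta>) * norm y)"
    using K0 norm_triangle_ineq4[of x "(\<mu> - \<zeta>) *\<^sub>C y"] by simp
  finally have "norm y * (1 - cmod (\<mu> - \<zeta>) * K) \<le> K * norm x"
    by (simp add: algebra_simps)
  then show "norm y \<le> K / (1 - cmod (\<mu> - \<zeta>) * K) * norm (\<mu> *\<^sub>C y - blinfun_apply T y)"
    using close by (simp add: x_def pos_le_divide_eq)
qed

text \<open>Division by \<open>\<zeta>\<close> leaves a contraction with factor
  \<open>norm T / cmod \<zeta>\<close>. The bound decays at infinity, as the Liouville argument
  requires.\<close>

lemma resolvent_bound_outside:
  assumes "norm T < cmod \<zeta>"
  shows "resolvent_bound T \<zeta> (1 / (cmod \<zeta> - norm T))"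
proof (rule resolvent_boundI)
  have \<zeta>: "\<zeta> \<noteq> 0" and pos: "cmod \<zeta> > 0"
    using assms norm_ge_zero[of T] by (auto simp del: norm_ge_zero)
  have eq: "\<zeta> *\<^sub>C y - blinfun_apply T y = x \<longleftrightarrow> (1 / \<zeta>) *\<^sub>C (x + blinfun_apply T y) = y" for x y
  proof
    assume "\<zeta> *\<^sub>C y - blinfun_apply T y = x"
    then have "x + blinfun_apply T y = \<zeta> *\<^sub>C y" by auto
    then show "(1 / \<zeta>) *\<^sub>C (x + blinfun_apply T y) = y"
      using \<zeta> by (simp add: scaleC_scaleC)
  next
    assume "(1 / \<zeta>) *\<^sub>C (x + blinfun_apply T y) = y"
    then have "\<zeta> *\<^sub>C y = \<zeta> *\<^sub>C ((1 / \<zeta>) *\<^sub>C (x + blinfun_apply T y))"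
      by simp
    then show "\<zeta> *\<^sub>C y - blinfun_apply T y = x"
      using \<zeta> by (simp only: scaleC_scaleC) simp
  qed
  show "\<exists>!y. \<zeta> *\<^sub>C y - blinfun_apply T y = x" for x
    unfolding eq
  proof (rule ex1_fixpoint_contraction)
    show "0 \<le> norm T / cmod \<zeta>" by simp
    show "norm T / cmod \<zeta> < 1" using assms pos by simp
    fix y z
    have "(1 / \<zeta>) *\<^sub>C (x + blinfun_apply T y) - (1 / \<zeta>) *\<^sub>C (x + blinfun_apply T z)
        = (1 / \<zeta>) *\<^sub>C blinfun_apply T (y - z)"
      unfolding complex_vector.scale_right_diff_distrib[symmetric] by (simp add: blinfun.diff_right)
    then show "norm ((1 / \<zeta>) *\<^sub>C (x + blinfun_apply T y) - (1 / \<zeta>) *\<^sub>C (x + blinfun_apply T z))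
        \<le> norm T / cmod \<zeta> * norm (y - z)"
      using pos norm_blinfun[of T "y - z"] by (simp add: norm_divide divide_right_mono)
  qed
  show "0 < 1 / (cmod \<zeta> - norm T)"
    using assms by simp
  fix y
  define x where "x = \<zeta> *\<^sub>C y - blinfun_apply T y"
  have "cmod \<zeta> * norm y = norm (x + blinfun_apply T y)"
    by (simp add: x_def)
  also have "\<dots> \<le> norm x + norm T * norm y"
    using norm_triangle_ineq[of x "blinfun_apply T y"] norm_blinfun[of T y] by linarith
  finally have "norm y * (cmod \<zeta> - norm T) \<le> norm x"
    by (simp add: algebra_simps)
  then show "norm y \<le> 1 / (cmod \<zeta> - norm T) * norm (\<zeta> *\<^sub>C y - blinfun_apply T y)"
    using assms by (simp add: x_def pos_le_divide_eq)
qed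

section \<open>Openness, growth and analyticity of the resolvent\<close>

lemma open_resolvent_set: "open (resolvent_set T)"
  unfolding open_contains_ball
proof
  fix \<zeta> assume "\<zeta> \<in> resolvent_set T"
  then obtain K where K: "resolvent_bound T \<zeta> K"
    by (auto simp: resolvent_set_def)
  then have K0: "K > 0"
    by (simp add: resolvent_bound_def)
  have "ball \<zeta> (1 / K) \<subseteq> resolvent_set T"
  proof
    fix \<mu> assume "\<mu> \<in> ball \<zeta> (1 / K)"
    then have "cmod (\<mu> - \<zeta>) * K < 1"
      using K0 by (simp add: dist_norm norm_minus_commute field_simps)
    then show "\<mu> \<in> resolvent_set T"
      using resolvent_bound_perturb[OF K] by (auto simp: resolvent_set_def)
  qed
  then show "\<exists>e>0. ball \<zeta> e \<subseteq> resolvent_set T"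
    using K0 by (intro exI[of _ "1 / K"]) simp
qed

text \<open>Contrapositive of the perturbation lemma: the resolvent grows at least like the
  reciprocal distance to the spectrum.\<close>

lemma resolvent_bound_spectrum_dist:
  assumes "resolvent_bound T \<zeta> K" and "\<mu> \<notin> resolvent_set T"
  shows "1 \<le> cmod (\<mu> - \<zeta>) * K"
  using resolvent_bound_perturb[OF assms(1), of \<mu>] assms(2)
  by (force simp: resolvent_set_def)

text \<open>The first resolvent identity. It gives the derivative of the resolvent and the
  orthogonality of eigenvectors and eigenfunctionals.\<close>

lemma resolvent_identity:
  assumes "\<zeta> \<in> resolvent_set T" "\<mu> \<in> resolvent_set T"
  shows "resolvent T \<mu> x - resolvent T \<zeta> x = (\<zeta> - \<mu>) *\<^sub>C resolvent T \<mu> (resolvent T \<zeta> x)"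
proof -
  let ?y = "resolvent T \<zeta> x"
  have "\<mu> *\<^sub>C ?y - blinfun_apply T ?y = x - (\<zeta> - \<mu>) *\<^sub>C ?y"
    using resolvent_right[OF assms(1), of x]
    by (simp add: complex_vector.scale_left_diff_distrib algebra_simps)
  then have "?y = resolvent T \<mu> (x - (\<zeta> - \<mu>) *\<^sub>C ?y)"
    using resolvent_left[OF assms(2)] by metis
  then have "?y = resolvent T \<mu> x - (\<zeta> - \<mu>) *\<^sub>C resolvent T \<mu> ?y"
    by (simp add: clinear_diff[OF clinear_resolvent[OF assms(2)]] clinear_scaleC[OF clinear_resolvent[OF assms(2)]])
  then show ?thesis
    by (metis add_diff_cancel_left' diff_add_cancel)
qed

lemma resolvent_locally_bounded:
  assumes "\<zeta> \<in> resolvent_set T"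
  obtains d K where "d > 0" "K > 0" and "\<And>\<mu>. cmod (\<mu> - \<zeta>) \<le> d \<Longrightarrow> resolvent_bound T \<mu> K"
proof -
  obtain K where K: "resolvent_bound T \<zeta> K"
    using assms by (auto simp: resolvent_set_def)
  then have K0: "K > 0"
    by (simp add: resolvent_bound_def)
  show ?thesis
  proof (rule that[of "1 / (2 * K)" "2 * K"])
    fix \<mu> assume "cmod (\<mu> - \<zeta>) \<le> 1 / (2 * K)"
    then have half: "cmod (\<mu> - \<zeta>) * K \<le> 1 / 2"
      using K0 by (simp add: field_simps)
    then have b: "resolvent_bound T \<mu> (K / (1 - cmod (\<mu> - \<zeta>) * K))"
      by (intro resolvent_bound_perturb K) simp
    have "K / (1 - cmod (\<mu> - \<zeta>) * K) \<le> K / (1 / 2)"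
      using half K0 by (intro divide_left_mono) auto
    then have "K / (1 - cmod (\<mu> - \<zeta>) * K) * norm x \<le> 2 * K * norm x" for x :: 'a
      by (intro mult_right_mono) auto
    then show "resolvent_bound T \<mu> (2 * K)"
      using b K0 unfolding resolvent_bound_def by (fastforce intro: order_trans)
  qed (use K0 in auto)
qed

text \<open>By the resolvent identity the difference quotient is the negative of \<open>f\<close> at
  the resolvent of \<open>y\<close>, so continuity in \<open>\<mu>\<close> suffices. That follows
  from the identity once more, with the local bound \<open>K\<close>.\<close>

lemma DERIV_resolvent:
  assumes f: "f \<in> complex_dual" and \<zeta>: "\<zeta> \<in> resolvent_set T"
  shows "((\<lambda>\<mu>. blinfun_apply f (resolvent T \<mu> x)) has_field_derivative
    - blinfun_apply f (resolvent T \<zeta> (resolvent T \<zeta> x))) (at \<zeta>)"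
proof -
  obtain d K where d: "d > 0" "K > 0" and K: "\<And>\<mu>. cmod (\<mu> - \<zeta>) \<le> d \<Longrightarrow> resolvent_bound T \<mu> K"
    using resolvent_locally_bounded[OF \<zeta>] by blast
  define y where "y = resolvent T \<zeta> x"
  have near: "eventually (\<lambda>\<mu>. cmod (\<mu> - \<zeta>) \<le> d \<and> \<mu> \<noteq> \<zeta>) (at \<zeta>)"
    unfolding eventually_at using d by (intro exI[of _ d]) (auto simp: dist_norm)
  have res: "\<mu> \<in> resolvent_set T" if "cmod (\<mu> - \<zeta>) \<le> d" for \<mu>
    using K[OF that] by (auto simp: resolvent_set_def)
  have lim: "((\<lambda>\<mu>. blinfun_apply f (resolvent T \<mu> y)) \<longlongrightarrow> blinfun_apply f (resolvent T \<zeta> y)) (at \<zeta>)"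
  proof (rule LIM_zero_cancel, rule Lim_null_comparison)
    show "eventually (\<lambda>\<mu>. norm (blinfun_apply f (resolvent T \<mu> y) - blinfun_apply f (resolvent T \<zeta> y))
        \<le> cmod (\<zeta> - \<mu>) * (norm f * (K * norm (resolvent T \<zeta> y)))) (at \<zeta>)"
      using near
    proof eventually_elim
      case (elim \<mu>)
      then have \<mu>: "\<mu> \<in> resolvent_set T" "resolvent_bound T \<mu> K"
        using K res by auto
      have "blinfun_apply f (resolvent T \<mu> y) - blinfun_apply f (resolvent T \<zeta> y)
          = (\<zeta> - \<mu>) * blinfun_apply f (resolvent T \<mu> (resolvent T \<zeta> y))"
        unfolding blinfun.diff_right[symmetric] resolvent_identity[OF \<zeta> \<mu>(1)] complex_dual_scaleC[OF f] ..
      moreover have "cmod (blinfun_apply f (resolvent T \<mu> (resolvent T \<zeta> y))) \<le> norm f * (K * norm (resolvent T \<zeta> y))"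
        using \<mu>(2) norm_blinfun[of f "resolvent T \<mu> (resolvent T \<zeta> y)"]
        unfolding resolvent_bound_def by (meson mult_left_mono norm_ge_zero order_trans)
      ultimately show ?case
        by (simp add: norm_mult mult_left_mono)
    qed
    show "((\<lambda>\<mu>. cmod (\<zeta> - \<mu>) * (norm f * (K * norm (resolvent T \<zeta> y)))) \<longlongrightarrow> 0) (at \<zeta>)"
      by (rule tendsto_eq_intros refl | simp)+
  qed
  have "((\<lambda>\<mu>. - blinfun_apply f (resolvent T \<mu> y)) \<longlongrightarrow> - blinfun_apply f (resolvent T \<zeta> y)) (at \<zeta>)"
    by (intro tendsto_minus lim)
  moreover have "eventually (\<lambda>\<mu>. - blinfun_apply f (resolvent T \<mu> y) =
      (blinfun_apply f (resolvent T \<mu> x) - blinfun_apply f (resolvent T \<zeta> x)) / (\<mu> - \<zeta>)) (at \<zeta>)"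
    using near
  proof eventually_elim
    case (elim \<mu>)
    then have \<mu>: "\<mu> \<in> resolvent_set T" "\<mu> - \<zeta> \<noteq> 0"
      using res by auto
    have "blinfun_apply f (resolvent T \<mu> x) - blinfun_apply f (resolvent T \<zeta> x) = (\<zeta> - \<mu>) * blinfun_apply f (resolvent T \<mu> y)"
      unfolding blinfun.diff_right[symmetric] resolvent_identity[OF \<zeta> \<mu>(1)] complex_dual_scaleC[OF f] y_def ..
    then show ?case
      using \<mu>(2) by (simp add: field_simps)
  qed
  ultimately show ?thesis
    unfolding has_field_derivative_iff y_def using Lim_transform_eventually by fastforce
qed

lemma holomorphic_on_resolvent:
  assumes "f \<in> complex_dual" "S \<subseteq> resolvent_set T"
  shows "(\<lambda>\<mu>. blinfun_apply f (resolvent T \<mu> x)) holomorphic_on S"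
  using DERIV_resolvent[OF assms(1)] assms(2)
  by (meson field_differentiable_at_within field_differentiable_def holomorphic_onI subsetD)

subsection \<open>Rank-one perturbations with an invariant half-space\<close>

lemma bounded_linear_resolvent:
  assumes "\<zeta> \<in> resolvent_set T"
  shows "bounded_linear (resolvent T \<zeta>)"
proof -
  obtain K where K: "resolvent_bound T \<zeta> K"
    using assms by (auto simp: resolvent_set_def)
  show ?thesis
    by (rule bounded_linear_intro[where K = K])
      (use K in \<open>auto simp: clinear_add[OF clinear_resolvent[OF assms]] clinear_scaleC[OF clinear_resolvent[OF assms]]
        scaleR_eq_scaleC resolvent_bound_def mult.commute\<close>)
qed

text \<open>The solutions are enumerated and split by parity: the odd eigenfunctionals
  \<open>\<phi>\<close> cut out \<open>Y\<close>, while the even eigenvectors \<open>h\<close> lie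
  in it and make it infinite-dimensional.\<close>

lemma invariant_half_space_rank_one:
  assumes f: "f \<in> complex_dual" and inf: "infinite {\<zeta> \<in> resolvent_set T. blinfun_apply f (resolvent T \<zeta> e) = 1}"
  shows "\<exists>F \<in> bounded_operators. rank_at_most 1 F \<and> norm F \<le> norm f * norm e \<and>
    (\<exists>Y. half_space Y \<and> blinfun_apply (T + F) ` Y \<subseteq> Y)"
proof -
  obtain \<xi> :: "nat \<Rightarrow> complex" where inj: "inj \<xi>"
    and \<xi>: "\<And>n. \<xi> n \<in> resolvent_set T" and sol: "\<And>n. blinfun_apply f (resolvent T (\<xi> n) e) = 1"
    using infinite_countable_subset[OF inf] by (auto simp: image_subset_iff)
  have bound: "norm (blinfun_apply f x *\<^sub>C e) \<le> norm x * (norm f * norm e)" for x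
    using mult_right_mono[OF norm_blinfun[of f x] norm_ge_zero[of e]] by (simp add: mult_ac)
  have bl: "bounded_linear (\<lambda>x. blinfun_apply f x *\<^sub>C e)"
    by (rule bounded_linear_intro[OF _ _ bound])
      (simp_all add: blinfun.add_right scaleC_add_left scaleR_eq_scaleC complex_dual_scaleC[OF f] scaleC_scaleC)
  define F where "F = Blinfun (\<lambda>x. blinfun_apply f x *\<^sub>C e)"
  have F: "blinfun_apply F x = blinfun_apply f x *\<^sub>C e" for x
    by (simp add: F_def bounded_linear_Blinfun_apply[OF bl])
  have clf: "clinear (blinfun_apply f)"
    using f by (rule clinear_complex_dual)
  have clF: "clinear (blinfun_apply F)"
    by (rule clinearI) (simp_all add: F blinfun.add_right scaleC_add_left complex_dual_scaleC[OF f] scaleC_scaleC)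
  define h where "h n = resolvent T (\<xi> n) e" for n
  define A where "A = blinfun_apply (T + F)"
  have A: "A x = blinfun_apply T x + blinfun_apply f x *\<^sub>C e" for x
    by (simp add: A_def blinfun.add_left F)
  have clA: "clinear A"
    by (rule clinearI) (simp_all add: A_def blinfun.add_left clinear_add[OF clF] clinear_add[OF clinear_T]
        clinear_scaleC[OF clF] clinear_scaleC[OF clinear_T] scaleC_add_right)
  define \<phi> where "\<phi> n x = blinfun_apply f (resolvent T (\<xi> n) x)" for n x
  have cl\<phi>: "clinear (\<phi> n)" for n
    by (rule clinearI) (simp_all add: \<phi>_def clinear_add[OF clinear_resolvent[OF \<xi>]] clinear_scaleC[OF clinear_resolvent[OF \<xi>]]
        blinfun.add_right complex_dual_scaleC[OF f])
  have bl\<phi>: "bounded_linear (\<phi> n)" for n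
    unfolding \<phi>_def by (intro bounded_linear_compose[OF blinfun.bounded_linear_right] bounded_linear_resolvent \<xi>)
  have eig: "A (h n) = \<xi> n *\<^sub>C h n" for n
    using resolvent_right[OF \<xi>, of n e] by (simp add: A h_def sol algebra_simps)
  have coeig: "\<phi> n (A x) = \<xi> n * \<phi> n x" for n x
  proof -
    have "\<phi> n (\<xi> n *\<^sub>C x - blinfun_apply T x) = blinfun_apply f x"
      by (simp add: \<phi>_def resolvent_left[OF \<xi>])
    then show ?thesis
      by (simp add: A clinear_diff[OF cl\<phi>] clinear_scaleC[OF cl\<phi>] clinear_add[OF cl\<phi>] algebra_simps)
        (simp add: \<phi>_def sol)
  qed
  \<comment> \<open>The resolvent identity reduces this to the difference of two values of
    \<open>f\<close>, both equal to 1.\<close>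
  have orth: "\<phi> m (h n) = 0" if "m \<noteq> n" for m n
  proof -
    have "(\<xi> n - \<xi> m) * \<phi> m (h n) = blinfun_apply f (resolvent T (\<xi> m) e - resolvent T (\<xi> n) e)"
      unfolding resolvent_identity[OF \<xi> \<xi>] \<phi>_def h_def complex_dual_scaleC[OF f] ..
    also have "\<dots> = 0"
      by (simp add: blinfun.diff_right sol)
    finally show ?thesis
      using inj that by (auto simp: inj_def)
  qed
  \<comment> \<open>The start vector is \<open>\<xi> m - T\<close> applied to \<open>h 0\<close>,
    where \<open>\<phi> m\<close> takes the value 1. Each factor
    \<open>A - \<xi> (2 * N + 1)\<close> then kills one more functional and rescales the others by
    non-zero numbers.\<close>
  have separate: "\<exists>x. (\<forall>i<N. \<phi> (2 * i + 1) x = 0) \<and> \<phi> (2 * n + 1) x \<noteq> 0" if "N \<le> n" for N n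
    using that
  proof (induction N)
    case 0
    let ?m = "2 * n + 1"
    have "\<phi> ?m (\<xi> ?m *\<^sub>C h 0 - blinfun_apply T (h 0)) = blinfun_apply f (h 0)"
      by (simp add: \<phi>_def resolvent_left[OF \<xi>])
    then show ?case
      by (intro exI[of _ "\<xi> ?m *\<^sub>C h 0 - blinfun_apply T (h 0)"]) (simp add: h_def sol)
  next
    case (Suc N)
    then obtain x where x: "\<And>i. i < N \<Longrightarrow> \<phi> (2 * i + 1) x = 0" "\<phi> (2 * n + 1) x \<noteq> 0"
      by auto
    define y where "y = A x - \<xi> (2 * N + 1) *\<^sub>C x"
    have y: "\<phi> m y = (\<xi> m - \<xi> (2 * N + 1)) * \<phi> m x" for m
      by (simp add: y_def clinear_diff[OF cl\<phi>] clinear_scaleC[OF cl\<phi>] coeig algebra_simps)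
    have "\<xi> (2 * n + 1) \<noteq> \<xi> (2 * N + 1)"
      using Suc.prems by (simp add: inj_eq[OF inj])
    then have "\<phi> (2 * n + 1) y \<noteq> 0"
      using x by (simp add: y)
    moreover have "\<phi> (2 * i + 1) y = 0" if "i < Suc N" for i
      using that x by (cases "i = N") (simp_all add: y)
    ultimately show ?case
      by blast
  qed
  have "\<exists>x. \<forall>n. (\<forall>i<n. \<phi> (2 * i + 1) (x n) = 0) \<and> \<phi> (2 * n + 1) (x n) \<noteq> 0"
    by (intro choice allI separate order_refl)
  then obtain x where x: "\<And>i n. i < n \<Longrightarrow> \<phi> (2 * i + 1) (x n) = 0" "\<And>n. \<phi> (2 * n + 1) (x n) \<noteq> 0"
    by blast
  define Y where "Y = (\<Inter>n. {x. \<phi> (2 * n + 1) x = 0})"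
  have "csubspace Y"
    unfolding Y_def complex_vector.subspace_def
    by (auto simp: clinear_0[OF cl\<phi>] clinear_add[OF cl\<phi>] clinear_scaleC[OF cl\<phi>])
  moreover have "closed Y"
    unfolding Y_def
    by (intro closed_INT ballI closed_Collect_eq continuous_on_const linear_continuous_on bl\<phi>)
  moreover have "infinite_cdim Y"
  proof (rule infinite_cdim_eigenvectors[OF clA, where h = "\<lambda>n. h (2 * n)" and \<mu> = "\<lambda>n. \<xi> (2 * n)"])
    show "inj (\<lambda>n. \<xi> (2 * n))"
      by (rule injI) (simp add: inj_eq[OF inj])
    show "h (2 * n) \<noteq> 0" for n
      using sol[of "2 * n"] by (auto simp: h_def)
    have "Suc (2 * m) \<noteq> 2 * n" for m n :: nat
      by presburger
    then show "range (\<lambda>n. h (2 * n)) \<subseteq> Y"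
      using orth by (auto simp: Y_def)
  qed (rule eig)
  moreover have "infinite_quotient_cdim Y"
    by (rule infinite_quotient_cdim_triangular[where x = x and \<phi> = "\<lambda>n. \<phi> (2 * n + 1)", OF \<open>csubspace Y\<close> cl\<phi> _ x])
      (simp_all add: Y_def)
  ultimately have "half_space Y"
    by (simp add: half_space_def)
  moreover have "A ` Y \<subseteq> Y"
    by (auto simp: Y_def coeig)
  moreover have "F \<in> bounded_operators"
    using clF by (simp add: bounded_operators_def)
  moreover have "norm F \<le> norm f * norm e"
    using bound by (intro norm_blinfun_bound) (auto simp: F mult_ac)
  moreover have "rank_at_most 1 F"
  proof -
    have "range (blinfun_apply F) = cspan {e}"
    proof -
      have "c *\<^sub>C e \<in> range (blinfun_apply F)" for c
      proof
        show "c *\<^sub>C e = blinfun_apply F (c *\<^sub>C h 0)"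
          by (simp add: F complex_dual_scaleC[OF f] h_def sol)
      qed simp
      then show ?thesis
        unfolding complex_vector.span_singleton by (auto simp: F)
    qed
    moreover have "cdim (cspan {e}) \<le> card {e}"
      by (intro complex_vector.dim_le_card) auto
    ultimately show ?thesis
      unfolding rank_at_most_def finite_cdim_def by (metis One_nat_def card.empty card.insert empty_iff
          finite.emptyI finite_insert)
  qed
  ultimately show ?thesis
    unfolding A_def by blast
qed

subsection \<open>Perturbations with few eigenvalues force poles\<close>

text \<open>Replacing \<open>e0\<close> by \<open>e0 + s x\<close> and \<open>f0\<close> by
  \<open>f0 + t \<phi>\<close> makes the equation bilinear in \<open>s\<close> and \<open>t\<close>,
  with the value of \<open>\<phi>\<close> at the resolvent of \<open>x\<close> as mixed coefficient.
  Absence of zeros bounds this coefficient by the unperturbed term.\<close>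

lemma resolvent_bound_if_no_solution:
  fixes e0 :: 'a
  assumes f0: "f0 \<in> complex_dual" and \<delta>: "\<delta> > 0" and \<zeta>: "\<zeta> \<in> resolvent_set T"
    and no: "\<And>e f. norm (e - e0) \<le> \<delta> \<Longrightarrow> norm (f - f0) \<le> \<delta> \<Longrightarrow> f \<in> complex_dual \<Longrightarrow>
      blinfun_apply f (resolvent T \<zeta> e) \<noteq> 1"
  shows "resolvent_bound T \<zeta> (8 / \<delta>\<^sup>2 * cmod (blinfun_apply f0 (resolvent T \<zeta> e0) - 1))"
proof -
  let ?R = "resolvent T \<zeta>"
  let ?a = "blinfun_apply f0 (?R e0) - 1"
  note cl = clinear_resolvent[OF \<zeta>]
  have unit: "norm (?R x) \<le> 8 / \<delta>\<^sup>2 * cmod ?a" if x: "norm x \<le> 1" for x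
  proof -
    obtain \<phi> where \<phi>: "\<phi> \<in> complex_dual" "norm \<phi> \<le> 2" "norm (?R x) \<le> cmod (blinfun_apply \<phi> (?R x))"
      by (rule almost_norming_functional)
    \<comment> \<open>The radius is \<open>\<delta> / 2\<close> because \<open>norm \<phi>\<close>
      may be 2; solving for the mixed coefficient then gives
      \<open>8 / \<delta>\<^sup>2\<close>.\<close>
    have "(\<delta> / 2)\<^sup>2 * cmod (blinfun_apply \<phi> (?R x)) \<le> 2 * cmod ?a"
    proof (rule bilinear_avoids_0_imp_small[where b = "blinfun_apply f0 (?R x)" and c = "blinfun_apply \<phi> (?R e0)"])
      fix s t :: complex
      assume s: "cmod s \<le> \<delta> / 2" and t: "cmod t \<le> \<delta> / 2"
      define \<psi> where "\<psi> = blinfun_mult_right t o\<^sub>L \<phi>"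
      have \<psi>: "blinfun_apply \<psi> y = t * blinfun_apply \<phi> y" for y
        by (simp add: \<psi>_def)
      have "norm \<psi> \<le> cmod t * norm \<phi>"
        using norm_blinfun[of \<phi>] by (intro norm_blinfun_bound) (auto simp: \<psi> norm_mult mult.assoc mult_left_mono)
      also have "\<dots> \<le> (\<delta> / 2) * 2"
        using \<phi> t \<delta> by (intro mult_mono) auto
      finally have "norm ((f0 + \<psi>) - f0) \<le> \<delta>"
        by simp
      moreover have "norm ((e0 + s *\<^sub>C x) - e0) \<le> \<delta>"
        using mult_mono[OF s x] \<delta> by simp
      moreover have "f0 + \<psi> \<in> complex_dual"
        using f0 \<phi> by (simp add: complex_dual_def blinfun.add_left \<psi> algebra_simps)
      ultimately have "blinfun_apply (f0 + \<psi>) (?R (e0 + s *\<^sub>C x)) \<noteq> 1"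
        by (intro no)
      moreover have "blinfun_apply (f0 + \<psi>) (?R (e0 + s *\<^sub>C x)) - 1 =
          ?a + s * blinfun_apply f0 (?R x) + t * blinfun_apply \<phi> (?R e0) + s * t * blinfun_apply \<phi> (?R x)"
        by (simp add: blinfun.add_left blinfun.add_right \<psi> clinear_add[OF cl] clinear_scaleC[OF cl]
            complex_dual_scaleC[OF f0] complex_dual_scaleC[OF \<phi>(1)] algebra_simps)
      ultimately show "?a + s * blinfun_apply f0 (?R x) + t * blinfun_apply \<phi> (?R e0)
          + s * t * blinfun_apply \<phi> (?R x) \<noteq> 0"
        by (metis eq_iff_diff_eq_0)
    qed (use \<delta> in simp)
    then have "cmod (blinfun_apply \<phi> (?R x)) \<le> 8 / \<delta>\<^sup>2 * cmod ?a"
      using \<delta> by (simp add: field_simps power2_eq_square)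
    then show ?thesis
      using \<phi> by linarith
  qed
  have "norm (?R x) \<le> 8 / \<delta>\<^sup>2 * cmod ?a * norm x" for x
  proof (cases "x = 0")
    case True
    then show ?thesis by (simp add: resolvent_0[OF \<zeta>])
  next
    case False
    have "norm (?R (complex_of_real (1 / norm x) *\<^sub>C x)) \<le> 8 / \<delta>\<^sup>2 * cmod ?a"
      by (rule unit) (simp add: False norm_divide)
    then have "norm (?R x) / norm x \<le> 8 / \<delta>\<^sup>2 * cmod ?a"
      by (simp add: clinear_scaleC[OF cl] norm_divide)
    then show ?thesis
      using False by (simp add: pos_divide_le_eq)
  qed
  moreover have "?a \<noteq> 0"
    using no[of e0 f0] f0 \<delta> by simp
  ultimately show ?thesis
    using \<delta> resolvent_set_bij[OF \<zeta>] by (simp add: resolvent_bound_def)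
qed

text \<open>The resolvent is bounded by a multiple of \<open>g\<close>, so the order of the zero of
  the extended \<open>1 / g\<^sup>2\<close> at \<open>\<zeta>0\<close> bounds the order of the
  pole.\<close>

lemma resolvent_pole_if_no_solution:
  fixes e0 :: 'a
  assumes f0: "f0 \<in> complex_dual" and \<delta>: "\<delta> > 0" and r: "r > 0"
    and \<zeta>0: "\<zeta>0 \<notin> resolvent_set T" "\<zeta>0 \<in> closure (resolvent_set T)"
    and no: "\<And>e f \<zeta>. norm (e - e0) \<le> \<delta> \<Longrightarrow> norm (f - f0) \<le> \<delta> \<Longrightarrow> f \<in> complex_dual \<Longrightarrow>
      \<zeta> \<in> resolvent_set T \<inter> ball \<zeta>0 r \<Longrightarrow> blinfun_apply f (resolvent T \<zeta> e) \<noteq> 1"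
  shows "\<exists>n r K. r > 0 \<and> K > 0 \<and> (\<forall>w \<in> ball \<zeta>0 r - {\<zeta>0}. w \<in> resolvent_set T \<and>
    (\<forall>x. cmod (w - \<zeta>0) ^ n * norm (resolvent T w x) \<le> K * norm x))"
proof -
  define g where "g w = blinfun_apply f0 (resolvent T w e0) - 1" for w
  define C where "C = 8 / \<delta>\<^sup>2"
  have C: "C > 0"
    using \<delta> by (simp add: C_def)
  have bound: "resolvent_bound T w (C * cmod (g w))" if "w \<in> resolvent_set T \<inter> ball \<zeta>0 r" for w
    unfolding C_def g_def using that by (intro resolvent_bound_if_no_solution f0 \<delta> no) auto
  have g0: "g w \<noteq> 0" if "w \<in> resolvent_set T \<inter> ball \<zeta>0 r" for w
    using bound[OF that] by (auto simp: resolvent_bound_def)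
  have holg: "g holomorphic_on resolvent_set T"
    unfolding g_def by (intro holomorphic_intros holomorphic_on_resolvent[OF f0]) auto
  text \<open>By the growth of the resolvent near the spectrum, \<open>1 / g\<close> is \<open>O(dist)\<close> at every spectral
    point; squaring makes its extension by \<open>0\<close> complex differentiable there.\<close>
  define v where "v w = (if w \<in> resolvent_set T then 1 / (g w)\<^sup>2 else 0)" for w
  have v_le: "cmod (v w) \<le> C\<^sup>2 * (cmod (w - \<mu>))\<^sup>2" if w: "w \<in> ball \<zeta>0 r" and \<mu>: "\<mu> \<notin> resolvent_set T" for w \<mu>
  proof (cases "w \<in> resolvent_set T")
    case True
    then have "1 \<le> cmod (\<mu> - w) * (C * cmod (g w))"
      using resolvent_bound_spectrum_dist[OF bound \<mu>] w by blast
    then have "1 / cmod (g w) \<le> C * cmod (w - \<mu>)"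
      using g0[of w] True w by (simp add: divide_le_eq norm_minus_commute mult_ac)
    then have "(1 / cmod (g w))\<^sup>2 \<le> (C * cmod (w - \<mu>))\<^sup>2"
      by (intro power_mono) auto
    then show ?thesis
      using True by (simp add: v_def norm_divide norm_power power_divide power_mult_distrib)
  qed (simp add: v_def)
  have holv: "v holomorphic_on ball \<zeta>0 r"
  proof (rule holomorphic_onI)
    fix \<mu> assume \<mu>: "\<mu> \<in> ball \<zeta>0 r"
    show "v field_differentiable at \<mu> within ball \<zeta>0 r"
    proof (cases "\<mu> \<in> resolvent_set T")
      case True
      have op: "open (resolvent_set T \<inter> ball \<zeta>0 r)"
        by (intro open_Int open_resolvent_set open_ball)
      have "(\<lambda>w. 1 / (g w)\<^sup>2) holomorphic_on resolvent_set T \<inter> ball \<zeta>0 r"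
        using g0 by (intro holomorphic_intros holomorphic_on_subset[OF holg]) auto
      then have "v holomorphic_on resolvent_set T \<inter> ball \<zeta>0 r"
        by (rule holomorphic_transform) (auto simp: v_def)
      then have "v field_differentiable at \<mu>"
        using op True \<mu> by (metis IntI holomorphic_on_imp_differentiable_at)
      then show ?thesis
        by (rule field_differentiable_at_within)
    next
      case False
      obtain r' where r': "r' > 0" "ball \<mu> r' \<subseteq> ball \<zeta>0 r"
        using \<mu> open_ball open_contains_ball by metis
      have "(v has_field_derivative 0) (at \<mu>)"
        by (rule has_field_derivative_0_if_quadratic[OF r'(1) _ v_le[OF subsetD[OF r'(2)] False]])
          (simp_all add: v_def False)
      then show ?thesis
        by (meson field_differentiable_at_within field_differentiable_def)
    qed
  qed
  \<comment> \<open>A boundary point has points of the resolvent set nearby; they keep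
    \<open>v\<close> from vanishing identically.\<close>
  obtain w1 where w1: "w1 \<in> resolvent_set T" "w1 \<in> ball \<zeta>0 r"
    using \<zeta>0(2) r unfolding closure_approachable by (auto simp: dist_commute)
  have v0: "v \<zeta>0 = 0" "v w1 \<noteq> 0"
    using \<zeta>0 w1 g0[of w1] by (auto simp: v_def)
  have nonconst: "\<not> v constant_on ball \<zeta>0 r"
    using v0 w1 r unfolding constant_on_def by (metis centre_in_ball)
  obtain u r1 n where u: "0 < n" "0 < r1" "ball \<zeta>0 r1 \<subseteq> ball \<zeta>0 r" "u holomorphic_on ball \<zeta>0 r1"
      "\<And>w. w \<in> ball \<zeta>0 r1 \<Longrightarrow> v w = (w - \<zeta>0) ^ n * u w" "\<And>w. w \<in> ball \<zeta>0 r1 \<Longrightarrow> u w \<noteq> 0"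
    by (rule holomorphic_factor_zero_nonconstant[OF holv open_ball connected_ball _ v0(1) nonconst])
      (use r in auto)
  have "continuous_on (cball \<zeta>0 (r1 / 2)) u"
    by (rule continuous_on_subset[OF holomorphic_on_imp_continuous_on[OF u(4)]]) (use u(2) in auto)
  then have "\<exists>z \<in> cball \<zeta>0 (r1 / 2). \<forall>w \<in> cball \<zeta>0 (r1 / 2). cmod (u z) \<le> cmod (u w)"
    using u(2) by (intro continuous_attains_inf) (auto intro!: continuous_intros)
  then obtain z where z: "z \<in> cball \<zeta>0 (r1 / 2)" "\<And>w. w \<in> cball \<zeta>0 (r1 / 2) \<Longrightarrow> cmod (u z) \<le> cmod (u w)"
    by blast
  have uz: "cmod (u z) > 0"
    using u(2,6) z(1) by auto
  \<comment> \<open>\<open>u\<close> is bounded below on the compact disc by its value at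
    \<open>z\<close>. The factor \<open>C * r\<close> pays for replacing \<open>cmod (g w)\<close>
    by its square, through \<open>1 \<le> C * r * cmod (g w)\<close>.\<close>
  define K where "K = C * (C * r) / cmod (u z)"
  have "w \<in> resolvent_set T \<and> (\<forall>x. cmod (w - \<zeta>0) ^ n * norm (resolvent T w x) \<le> K * norm x)"
    if w: "w \<in> ball \<zeta>0 (r1 / 2) - {\<zeta>0}" for w
  proof -
    have w': "w \<in> ball \<zeta>0 r1" "w \<in> cball \<zeta>0 (r1 / 2)" "w \<noteq> \<zeta>0"
      using w u(2) by auto
    then have wr: "w \<in> ball \<zeta>0 r"
      using u(3) by blast
    \<comment> \<open>Off the resolvent set \<open>v\<close> is 0, so the factorization shows that
      \<open>\<zeta>0\<close> is isolated in the spectrum.\<close>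
    have vw: "v w = (w - \<zeta>0) ^ n * u w" "v w \<noteq> 0"
      using w' u(5,6) by auto
    then have wres: "w \<in> resolvent_set T"
      by (auto simp: v_def split: if_splits)
    have vg: "cmod (v w) * (cmod (g w))\<^sup>2 = 1"
      using wres g0[of w] wr by (simp add: v_def norm_divide norm_power)
    have "1 \<le> cmod (\<zeta>0 - w) * (C * cmod (g w))"
      using resolvent_bound_spectrum_dist[OF bound \<zeta>0(1)] wres wr by blast
    also have "\<dots> \<le> r * (C * cmod (g w))"
      using wr C by (intro mult_right_mono) (auto simp: dist_norm)
    finally have g1: "1 \<le> C * r * cmod (g w)"
      by (simp add: mult_ac)
    have "cmod (w - \<zeta>0) ^ n * (C * cmod (g w)) \<le> K"
    proof -
      have "cmod (w - \<zeta>0) ^ n * cmod (u z) \<le> cmod (v w)"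
        using z(2)[OF w'(2)] by (simp add: vw norm_mult norm_power mult_left_mono)
      then have "cmod (w - \<zeta>0) ^ n * cmod (u z) * (C * cmod (g w)) \<le> cmod (v w) * (C * cmod (g w))"
        using C by (intro mult_right_mono) auto
      also have "\<dots> \<le> cmod (v w) * (C * cmod (g w)) * (C * r * cmod (g w))"
        using mult_left_mono[OF g1, of "cmod (v w) * (C * cmod (g w))"] C by simp
      also have "\<dots> = (cmod (v w) * (cmod (g w))\<^sup>2) * (C * (C * r))"
        by (simp add: power2_eq_square mult_ac)
      finally show ?thesis
        using uz by (simp add: K_def vg pos_le_divide_eq mult_ac)
    qed
    moreover have "norm (resolvent T w x) \<le> C * cmod (g w) * norm x" for x
      using bound[of w] wres wr by (simp add: resolvent_bound_def)
    ultimately have "cmod (w - \<zeta>0) ^ n * norm (resolvent T w x) \<le> K * norm x" for x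
      by (smt (verit, ccfv_SIG) mult.assoc mult_left_mono mult_right_mono norm_ge_zero zero_le_power)
    then show ?thesis
      using wres by blast
  qed
  moreover have "K > 0" "r1 / 2 > 0"
    using C r uz u(2) by (simp_all add: K_def)
  ultimately show ?thesis
    by blast
qed

text \<open>A Rouche-type argument: finiteness provides a circle around \<open>\<zeta>1\<close> free
  of solutions, and after a small perturbation the function is still smaller at the centre than on
  the circle, which forces a zero inside.\<close>

lemma solution_persists:
  fixes e :: 'a
  assumes f: "f \<in> complex_dual" and fin: "finite {\<zeta> \<in> resolvent_set T. blinfun_apply f (resolvent T \<zeta> e) = 1}"
    and U: "open U" "U \<subseteq> resolvent_set T" and \<zeta>1: "\<zeta>1 \<in> U" "blinfun_apply f (resolvent T \<zeta>1 e) = 1"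
  obtains \<epsilon> where "\<epsilon> > 0" and "\<And>e' f'. f' \<in> complex_dual \<Longrightarrow> norm (e' - e) < \<epsilon> \<Longrightarrow> norm (f' - f) < \<epsilon> \<Longrightarrow>
    \<exists>\<zeta>\<in>U. blinfun_apply f' (resolvent T \<zeta> e') = 1"
proof -
  define sols where "sols = {\<zeta> \<in> resolvent_set T. blinfun_apply f (resolvent T \<zeta> e) = 1}"
  obtain d1 K where d1: "d1 > 0" "K > 0" and K: "\<And>\<mu>. cmod (\<mu> - \<zeta>1) \<le> d1 \<Longrightarrow> resolvent_bound T \<mu> K"
    using resolvent_locally_bounded[of \<zeta>1] \<zeta>1 U by blast
  have "open (U - (sols - {\<zeta>1}))"
    using fin U by (intro open_Diff finite_imp_closed) (auto simp: sols_def)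
  moreover have "\<zeta>1 \<in> U - (sols - {\<zeta>1})"
    using \<zeta>1 by simp
  ultimately obtain d2 where d2: "d2 > 0" "cball \<zeta>1 d2 \<subseteq> U - (sols - {\<zeta>1})"
    unfolding open_contains_cball by blast
  define d where "d = min d1 d2"
  have d: "d > 0" "d \<le> d1" "d \<le> d2"
    using d1 d2 by (auto simp: d_def)
  have cb: "cball \<zeta>1 d \<subseteq> U - (sols - {\<zeta>1})"
    using d2 d(3) by force
  have dU: "cball \<zeta>1 d \<subseteq> U"
    using cb by blast
  have dK: "resolvent_bound T \<mu> K" if "\<mu> \<in> cball \<zeta>1 d" for \<mu>
    using that d K by (auto simp: dist_norm norm_minus_commute)
  define G where "G e' f' \<zeta> = blinfun_apply f' (resolvent T \<zeta> e') - 1" for e' :: 'a and f' :: "'a \<Rightarrow>\<^sub>L complex" and \<zeta>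
  have holG: "G e' f' holomorphic_on cball \<zeta>1 d" if "f' \<in> complex_dual" for e' f'
    unfolding G_def using dU U by (intro holomorphic_intros holomorphic_on_resolvent[OF that]) auto
  have contG: "continuous_on (cball \<zeta>1 d) (G e' f')" if "f' \<in> complex_dual" for e' f'
    by (rule holomorphic_on_imp_continuous_on[OF holG[OF that]])
  have "\<exists>z \<in> sphere \<zeta>1 d. \<forall>w \<in> sphere \<zeta>1 d. cmod (G e f z) \<le> cmod (G e f w)"
    using d(1) by (intro continuous_attains_inf continuous_intros continuous_on_subset[OF contG[OF f]])
      (auto simp: sphere_eq_empty)
  then obtain z where z: "z \<in> sphere \<zeta>1 d" "\<And>w. w \<in> sphere \<zeta>1 d \<Longrightarrow> cmod (G e f z) \<le> cmod (G e f w)"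
    by blast
  define m where "m = cmod (G e f z)"
  have m: "m > 0"
  proof -
    have "z \<noteq> \<zeta>1" "z \<in> cball \<zeta>1 d"
      using z(1) d(1) by auto
    then have "z \<notin> sols" "z \<in> resolvent_set T"
      using cb U by auto
    then show ?thesis
      by (simp add: m_def G_def sols_def)
  qed
  define L where "L = K * (norm e + 1 + norm f)"
  have L: "L > 0"
    using d1 unfolding L_def by (intro mult_pos_pos) (auto simp: add_pos_nonneg add_nonneg_pos)
  \<comment> \<open>The 1 yields \<open>norm e' \<le> norm e + 1\<close>; the other term keeps the
    change of \<open>G\<close> on the disc below half of its minimum modulus \<open>m\<close> on the
    circle.\<close>
  define \<epsilon> where "\<epsilon> = min 1 (m / (2 * L))"
  have close: "cmod (G e' f' w - G e f w) < m / 2"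
    if "norm (e' - e) < \<epsilon>" "norm (f' - f) < \<epsilon>" "w \<in> cball \<zeta>1 d" for e' f' w
  proof -
    have w: "w \<in> resolvent_set T"
      using that(3) dU U by blast
    have RK: "norm (resolvent T w x) \<le> K * norm x" for x
      using dK[OF that(3)] by (simp add: resolvent_bound_def)
    have "G e' f' w - G e f w = blinfun_apply (f' - f) (resolvent T w e') + blinfun_apply f (resolvent T w (e' - e))"
      by (simp add: G_def blinfun.diff_left blinfun.diff_right clinear_diff[OF clinear_resolvent[OF w]])
    also have "cmod \<dots> \<le> norm (f' - f) * norm (resolvent T w e') + norm f * norm (resolvent T w (e' - e))"
      using norm_blinfun[of "f' - f" "resolvent T w e'"] norm_blinfun[of f "resolvent T w (e' - e)"]
      by (intro norm_triangle_le add_mono)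
    also have "\<dots> \<le> norm (f' - f) * (K * (norm e + 1)) + norm f * (K * norm (e' - e))"
    proof (intro add_mono mult_left_mono norm_ge_zero RK)
      have "norm e' \<le> norm e + 1"
        using that(1) norm_triangle_sub[of e' e] by (simp add: \<epsilon>_def)
      then show "norm (resolvent T w e') \<le> K * (norm e + 1)"
        using RK[of e'] d1(2) by (smt (verit) mult_left_mono)
    qed
    also have "\<dots> \<le> max (norm (f' - f)) (norm (e' - e)) * L"
    proof -
      have "norm (f' - f) * (K * (norm e + 1)) \<le> max (norm (f' - f)) (norm (e' - e)) * (K * (norm e + 1))"
        "norm (e' - e) * (K * norm f) \<le> max (norm (f' - f)) (norm (e' - e)) * (K * norm f)"
        using d1(2) by (intro mult_right_mono; simp)+
      then show ?thesis
        by (simp add: L_def algebra_simps)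
    qed
    also have "\<dots> < m / (2 * L) * L"
      using that L by (intro mult_strict_right_mono) (auto simp: \<epsilon>_def)
    also have "\<dots> = m / 2"
      using L by simp
    finally show ?thesis .
  qed
  show ?thesis
  proof (rule that[of \<epsilon>])
    show "\<epsilon> > 0"
      using m L by (simp add: \<epsilon>_def)
    fix e' f' assume f': "f' \<in> complex_dual" and near: "norm (e' - e) < \<epsilon>" "norm (f' - f) < \<epsilon>"
    have "\<exists>z\<in>ball \<zeta>1 d. G e' f' z = 0"
    proof (rule holomorphic_contract_to_zero[OF contG[OF f'] holomorphic_on_subset[OF holG[OF f'] ball_subset_cball] d(1)])
      fix w assume w: "cmod (\<zeta>1 - w) = d"
      have "cmod (G e' f' \<zeta>1) < m / 2"
        using close[OF near, of \<zeta>1] d(1) \<zeta>1 by (simp add: G_def)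
      moreover have "m \<le> cmod (G e f w)"
        unfolding m_def using w by (intro z) (simp add: dist_norm)
      moreover have "cmod (G e' f' w - G e f w) < m / 2"
        using w by (intro close near) (simp add: dist_norm)
      ultimately show "cmod (G e' f' \<zeta>1) < cmod (G e' f' w)"
        using norm_triangle_sub[of "G e f w" "G e' f' w"] by (simp add: norm_minus_commute)
    qed blast
    then show "\<exists>\<zeta>\<in>U. blinfun_apply f' (resolvent T \<zeta> e') = 1"
      using dU ball_subset_cball unfolding G_def by fastforce
  qed
qed

text \<open>Baire's theorem in the complete space \<open>M\<close> of small pairs: the sets
  \<open>A n\<close> of pairs without a solution within distance \<open>1 / Suc n\<close> of
  \<open>\<zeta>0\<close> are closed, because solutions persist, and they cover
  \<open>M\<close>.\<close>

lemma no_solutions_near: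
  assumes s: "s > 0" and \<zeta>0: "\<zeta>0 \<notin> resolvent_set T"
    and fin: "\<And>e f. norm e \<le> s \<Longrightarrow> norm f \<le> s \<Longrightarrow> f \<in> complex_dual \<Longrightarrow>
      finite {\<zeta> \<in> resolvent_set T. blinfun_apply f (resolvent T \<zeta> e) = 1}"
  obtains e0 :: 'a and f0 \<delta> r where "f0 \<in> complex_dual" "\<delta> > 0" "r > 0"
    and "\<And>e f \<zeta>. norm (e - e0) \<le> \<delta> \<Longrightarrow> norm (f - f0) \<le> \<delta> \<Longrightarrow> f \<in> complex_dual \<Longrightarrow>
      \<zeta> \<in> resolvent_set T \<inter> ball \<zeta>0 r \<Longrightarrow> blinfun_apply f (resolvent T \<zeta> e) \<noteq> 1"
proof -
  define M :: "('a \<times> ('a \<Rightarrow>\<^sub>L complex)) set" where "M = {p. norm (fst p) \<le> s \<and> norm (snd p) \<le> s \<and> snd p \<in> complex_dual}"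
  define U where "U n = resolvent_set T \<inter> ball \<zeta>0 (1 / Suc n)" for n
  define A where "A n = {p \<in> M. \<forall>\<zeta>\<in>U n. blinfun_apply (snd p) (resolvent T \<zeta> (fst p)) \<noteq> 1}" for n
  have openU: "open (U n)" for n
    unfolding U_def by (intro open_Int open_resolvent_set open_ball)
  have "M = {p. norm (fst p) \<le> s} \<inter> {p. norm (snd p) \<le> s} \<inter>
      (\<Inter>c x. {p. blinfun_apply (snd p) (c *\<^sub>C x) = c * blinfun_apply (snd p) x})"
    by (auto simp: M_def complex_dual_def)
  moreover have "closed \<dots>"
    by (intro closed_Int closed_INT ballI closed_Collect_le closed_Collect_eq continuous_intros)
  ultimately have closedM: "closed M"
    by simp
  have cm: "completely_metrizable_space (top_of_set M)"
    using closedM closed_closedin completely_metrizable_space_closedin completely_metrizable_space_euclidean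
    by blast
  have closedA: "closedin (top_of_set M) (A n)" for n
  proof -
    have "openin (top_of_set M) (M - A n)"
      unfolding openin_euclidean_subtopology_iff
    proof (intro conjI ballI)
      fix p assume p: "p \<in> M - A n"
      then obtain \<zeta>1 where \<zeta>1: "\<zeta>1 \<in> U n" "blinfun_apply (snd p) (resolvent T \<zeta>1 (fst p)) = 1"
        by (auto simp: A_def)
      have h: "snd p \<in> complex_dual" "finite {\<zeta> \<in> resolvent_set T. blinfun_apply (snd p) (resolvent T \<zeta> (fst p)) = 1}"
        using p fin by (auto simp: M_def)
      have Un: "U n \<subseteq> resolvent_set T"
        by (simp add: U_def)
      obtain \<epsilon> where \<epsilon>: "\<epsilon> > 0" "\<And>e' f'. f' \<in> complex_dual \<Longrightarrow> norm (e' - fst p) < \<epsilon> \<Longrightarrow> norm (f' - snd p) < \<epsilon> \<Longrightarrow>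
          \<exists>\<zeta>\<in>U n. blinfun_apply f' (resolvent T \<zeta> e') = 1"
        using solution_persists[OF h openU Un \<zeta>1] by blast
      show "\<exists>\<epsilon>>0. \<forall>q\<in>M. dist q p < \<epsilon> \<longrightarrow> q \<in> M - A n"
      proof (intro exI[of _ \<epsilon>] conjI ballI impI \<epsilon>(1))
        fix q assume q: "q \<in> M" "dist q p < \<epsilon>"
        have "norm (fst q - fst p) < \<epsilon>" "norm (snd q - snd p) < \<epsilon>"
          using q(2) dist_fst_le[of q p] dist_snd_le[of q p] by (simp_all add: dist_norm)
        then show "q \<in> M - A n"
          using \<epsilon>(2)[of "snd q" "fst q"] q(1) by (auto simp: A_def M_def)
      qed
    qed blast
    moreover have "A n \<subseteq> M"
      by (auto simp: A_def)
    ultimately show ?thesis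
      by (simp add: closedin_def)
  qed
  have "\<exists>n. top_of_set M interior_of A n \<noteq> {}"
  proof (rule ccontr)
    assume "\<not> ?thesis"
    then have "top_of_set M interior_of \<Union>(range A) = {}"
      using closedA by (intro Baire_category_alt) (auto simp: cm)
    moreover have "\<Union>(range A) = M"
    proof
      show "\<Union>(range A) \<subseteq> M"
        by (auto simp: A_def)
      show "M \<subseteq> \<Union>(range A)"
      proof
        \<comment> \<open>The solutions for \<open>p\<close> are finite in number and differ from
          the spectral point \<open>\<zeta>0\<close>, so a small ball around it avoids them.\<close>
        fix p assume p: "p \<in> M"
        define S where "S = {\<zeta> \<in> resolvent_set T. blinfun_apply (snd p) (resolvent T \<zeta> (fst p)) = 1}"
        have "finite S" "\<zeta>0 \<notin> S"
          using p fin \<zeta>0 by (auto simp: M_def S_def)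
        then obtain d where d: "d > 0" "\<And>x. x \<in> S \<Longrightarrow> d \<le> dist \<zeta>0 x"
          using finite_set_avoid[of S \<zeta>0] by metis
        obtain n where "1 / real (Suc n) < d"
          using nat_approx_posE[OF d(1)] by metis
        then have "p \<in> A n"
          using p d(2) by (force simp: A_def U_def S_def)
        then show "p \<in> \<Union>(range A)"
          by blast
      qed
    qed
    moreover have "(0, 0) \<in> M"
      using s by (simp add: M_def complex_dual_def)
    moreover have "top_of_set M interior_of M = M"
      using interior_of_topspace[of "top_of_set M"] by simp
    ultimately show False
      by auto
  qed
  then obtain n p where "p \<in> top_of_set M interior_of A n"
    by blast
  then obtain V where V: "openin (top_of_set M) V" "V \<subseteq> A n" "p \<in> V"
    unfolding interior_of_def by blast
  then obtain d where p: "p \<in> M" and d: "d > 0" "\<And>q. q \<in> M \<Longrightarrow> dist q p < d \<Longrightarrow> q \<in> A n"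
    unfolding openin_euclidean_subtopology_iff by (meson subsetD)
  \<comment> \<open>The interior point \<open>p\<close> may have components of norm
    \<open>s\<close>. Scaling it by \<open>1 - \<eta>\<close> moves it by less than
    \<open>d / 2\<close> and leaves room \<open>\<eta> * s\<close> in both components, so a full
    ball in the dual variables fits into \<open>M\<close>.\<close>
  define \<eta> where "\<eta> = min (1 / 2) (d / (4 * (norm p + 1)))"
  have \<eta>: "\<eta> > 0" "\<eta> \<le> 1" "\<eta> * norm p < d / 2"
  proof -
    show "\<eta> > 0" "\<eta> \<le> 1"
      using d(1) by (auto simp: \<eta>_def add_nonneg_pos)
    have "\<eta> * norm p \<le> d / (4 * (norm p + 1)) * norm p"
      by (intro mult_right_mono) (auto simp: \<eta>_def)
    also have "\<dots> = d / 4 * (norm p / (norm p + 1))"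
      by simp
    also have "\<dots> \<le> d / 4 * 1"
      using d(1) by (intro mult_left_mono) (auto simp: divide_le_eq_1 add_nonneg_pos)
    finally show "\<eta> * norm p < d / 2"
      using d(1) by simp
  qed
  define \<delta> where "\<delta> = min (\<eta> * s) (d / 4)"
  have \<delta>: "\<delta> > 0" "\<delta> \<le> \<eta> * s" "\<delta> \<le> d / 4"
    using \<eta> s d by (auto simp: \<delta>_def)
  show ?thesis
  proof (rule that[of "snd ((1 - \<eta>) *\<^sub>R p)" \<delta> "1 / Suc n" "fst ((1 - \<eta>) *\<^sub>R p)"])
    show "snd ((1 - \<eta>) *\<^sub>R p) \<in> complex_dual"
      using p by (simp add: M_def complex_dual_def blinfun.scaleR_left)
    fix e f \<zeta>
    assume e: "norm (e - fst ((1 - \<eta>) *\<^sub>R p)) \<le> \<delta>" and f: "norm (f - snd ((1 - \<eta>) *\<^sub>R p)) \<le> \<delta>"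
      and fd: "f \<in> complex_dual" and \<zeta>: "\<zeta> \<in> resolvent_set T \<inter> ball \<zeta>0 (1 / Suc n)"
    have shrink: "(1 - \<eta>) * t + \<delta> \<le> s" if "t \<le> s" for t
      using mult_left_mono[OF that, of "1 - \<eta>"] \<eta> \<delta> by (simp add: algebra_simps)
    have "norm e \<le> (1 - \<eta>) * norm (fst p) + \<delta>" "norm f \<le> (1 - \<eta>) * norm (snd p) + \<delta>"
      using norm_triangle_sub[of e "fst ((1 - \<eta>) *\<^sub>R p)"] norm_triangle_sub[of f "snd ((1 - \<eta>) *\<^sub>R p)"] e f \<eta>
      by simp_all
    then have "norm e \<le> s" "norm f \<le> s"
      using shrink[of "norm (fst p)"] shrink[of "norm (snd p)"] p by (auto simp: M_def)
    then have "(e, f) \<in> M"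
      using fd by (simp add: M_def)
    moreover have "dist (e, f) p < d"
    proof -
      have "norm ((e, f) - (1 - \<eta>) *\<^sub>R p) \<le> norm (e - fst ((1 - \<eta>) *\<^sub>R p)) + norm (f - snd ((1 - \<eta>) *\<^sub>R p))"
        using norm_Pair_le[of "e - fst ((1 - \<eta>) *\<^sub>R p)" "f - snd ((1 - \<eta>) *\<^sub>R p)"]
        by (simp add: minus_prod_def)
      moreover have "norm ((1 - \<eta>) *\<^sub>R p - p) = \<eta> * norm p"
        using \<eta> by (simp add: algebra_simps)
      moreover have "norm ((e, f) - p) \<le> norm ((e, f) - (1 - \<eta>) *\<^sub>R p) + norm ((1 - \<eta>) *\<^sub>R p - p)"
        using norm_triangle_ineq[of "(e, f) - (1 - \<eta>) *\<^sub>R p" "(1 - \<eta>) *\<^sub>R p - p"] by simp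
      ultimately show ?thesis
        using e f \<delta> \<eta> by (simp add: dist_norm)
    qed
    ultimately have "(e, f) \<in> A n"
      by (rule d)
    then show "blinfun_apply f (resolvent T \<zeta> e) \<noteq> 1"
      using \<zeta> by (auto simp: A_def U_def)
  qed (use \<delta> in auto)
qed

subsection \<open>Operators with finite spectrum consisting of poles\<close>

lemma clinear_shift_prod: "clinear (shift_prod T as)"
proof (induction as)
  case Nil
  show ?case by (rule clinearI) simp_all
next
  case (Cons a as)
  show ?case
    by (rule clinearI) (simp_all add: clinear_add[OF Cons] clinear_scaleC[OF Cons]
        clinear_add[OF clinear_T] clinear_scaleC[OF clinear_T] scaleC_add_right
        scaleC_scaleC complex_vector.scale_right_diff_distrib mult.commute)
qed

text \<open>If all eigenspaces were finite-dimensional, so would be the kernel of every product of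
  shifts, by induction through preimages; here that kernel is the whole space.\<close>

lemma infinite_eigenspace:
  assumes inf: "infinite_cdim (UNIV :: 'a set)" and zero: "\<And>x. shift_prod T as x = 0"
  obtains a where "infinite_cdim {x. blinfun_apply T x = a *\<^sub>C x}"
proof (rule ccontr)
  assume no: "\<not> thesis"
  have "finite_cdim {x. shift_prod T as x = 0}"
  proof (induction as)
    case Nil
    have "cspan {} = {x :: 'a. x = 0}"
      by auto
    then show ?case
      unfolding finite_cdim_def by (intro exI[of _ "{}"]) simp
  next
    case (Cons a as)
    have "finite_cdim {x. blinfun_apply T x = a *\<^sub>C x}"
      using no that by blast
    from finite_cdim_vimage[OF clinear_shift_prod Cons this] show ?case
      by simp
  qed
  then show False
    using inf zero by simp
qed

text \<open>Polynomial division by \<open>w - T\<close>: up to an entire remainder, a polynomial in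
  \<open>T\<close> under the resolvent acts as its scalar value at \<open>w\<close>. The induction
  step moves one factor \<open>T - a\<close> through the resolvent.\<close>

lemma resolvent_shift_prod:
  assumes f: "f \<in> complex_dual"
  shows "\<exists>p. p holomorphic_on UNIV \<and> (\<forall>w \<in> resolvent_set T.
    blinfun_apply f (resolvent T w (shift_prod T as x)) =
      prod_list (map (\<lambda>a. w - a) as) * blinfun_apply f (resolvent T w x) + p w)"
proof (induction as)
  case Nil
  show ?case
    by (intro exI[of _ "\<lambda>_. 0"]) simp
next
  case (Cons a as)
  then obtain p where p: "p holomorphic_on UNIV"
    "\<And>w. w \<in> resolvent_set T \<Longrightarrow> blinfun_apply f (resolvent T w (shift_prod T as x)) =
      prod_list (map (\<lambda>a. w - a) as) * blinfun_apply f (resolvent T w x) + p w"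
    by blast
  define y where "y = shift_prod T as x"
  have "blinfun_apply f (resolvent T w (shift_prod T (a # as) x)) =
      prod_list (map (\<lambda>a. w - a) (a # as)) * blinfun_apply f (resolvent T w x) +
      ((w - a) * p w - blinfun_apply f y)" if w: "w \<in> resolvent_set T" for w
  proof -
    have "w *\<^sub>C resolvent T w y - resolvent T w (blinfun_apply T y) = y"
      using resolvent_left[OF w, of y]
      by (simp add: clinear_diff[OF clinear_resolvent[OF w]] clinear_scaleC[OF clinear_resolvent[OF w]])
    then have "resolvent T w (blinfun_apply T y) = w *\<^sub>C resolvent T w y - y"
      by (auto simp: algebra_simps)
    then have "blinfun_apply f (resolvent T w (blinfun_apply T y)) = w * blinfun_apply f (resolvent T w y) - blinfun_apply f y"
      by (simp add: blinfun.diff_right complex_dual_scaleC[OF f])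
    then have "blinfun_apply f (resolvent T w (shift_prod T (a # as) x)) =
        (w - a) * blinfun_apply f (resolvent T w y) - blinfun_apply f y"
      by (simp add: clinear_diff[OF clinear_resolvent[OF w]] clinear_scaleC[OF clinear_resolvent[OF w]]
          blinfun.diff_right complex_dual_scaleC[OF f] left_diff_distrib flip: y_def)
    then show ?thesis
      by (simp add: p(2)[OF w, folded y_def] algebra_simps)
  qed
  moreover have "(\<lambda>w. (w - a) * p w - blinfun_apply f y) holomorphic_on UNIV"
    by (intro holomorphic_intros p)
  ultimately show ?case
    by (intro exI[of _ "\<lambda>w. (w - a) * p w - blinfun_apply f y"]) blast
qed

section \<open>Finiteness of the spectrum and the annihilating polynomial\<close>

lemma resolvent_set_nonempty: "resolvent_set T \<noteq> {}"
proof -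
  have "complex_of_real (norm T + 1) \<in> resolvent_set T"
    using resolvent_bound_outside[of "complex_of_real (norm T + 1)"]
    by (auto simp: resolvent_set_def simp del: of_real_add)
  then show ?thesis
    by blast
qed

text \<open>Poles are isolated, so the compact boundary \<open>S\<close> is finite. Its complement
  is therefore connected and cannot be split between the resolvent set and the interior of the
  spectrum.\<close>

lemma finite_spectrum_if_poles:
  assumes "\<And>\<zeta>. \<zeta> \<in> closure (resolvent_set T) \<Longrightarrow> \<zeta> \<notin> resolvent_set T \<Longrightarrow> \<exists>n. spectral_pole T \<zeta> n"
  shows "finite (- resolvent_set T)" and "closure (resolvent_set T) = UNIV"
proof -
  define S where "S = closure (resolvent_set T) - resolvent_set T"
  have bounded: "- resolvent_set T \<subseteq> cball 0 (norm T)"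
    using resolvent_bound_outside by (force simp: resolvent_set_def)
  then have "bounded S"
    by (rule bounded_subset[OF bounded_cball order_trans[rotated]]) (auto simp: S_def)
  moreover have "closed S"
    unfolding S_def by (intro closed_Diff closed_closure open_resolvent_set)
  ultimately have "compact S"
    by (simp add: compact_eq_bounded_closed)
  have "finite S"
  proof (rule ccontr)
    assume "infinite S"
    then obtain x where x: "x \<in> S" "x islimpt S"
      using \<open>compact S\<close> unfolding compact_eq_Bolzano_Weierstrass by blast
    then obtain n where "spectral_pole T x n"
      using assms by (auto simp: S_def)
    then obtain r where r: "r > 0" "\<And>w. w \<in> ball x r - {x} \<Longrightarrow> w \<in> resolvent_set T"
      unfolding spectral_pole_def by blast
    obtain y where "y \<in> S" "y \<noteq> x" "dist y x < r"
      using x(2) r(1) unfolding islimpt_approachable by blast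
    then show False
      using r(2)[of y] by (simp add: S_def dist_commute)
  qed
  have "connected (UNIV - S)"
    by (intro connected_open_delete_finite \<open>finite S\<close>) auto
  moreover have "open (- closure (resolvent_set T))"
    by (simp add: open_Compl)
  ultimately have "resolvent_set T \<inter> (UNIV - S) = {} \<or> - closure (resolvent_set T) \<inter> (UNIV - S) = {}"
    using closure_subset[of "resolvent_set T"]
    by (intro connectedD open_resolvent_set) (auto simp: S_def)
  then show "closure (resolvent_set T) = UNIV"
    using resolvent_set_nonempty by (auto simp: S_def)
  then show "finite (- resolvent_set T)"
    using \<open>finite S\<close> by (simp add: S_def Compl_eq_Diff_UNIV)
qed

text \<open>A polynomial \<open>q\<close> with zeros of sufficient order at the spectral points
  cancels all poles. The resolvent applied to \<open>q(T) x\<close> is then weakly entire and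
  vanishes at infinity, so it is 0 by Liouville's theorem.\<close>

lemma algebraic_if_poles:
  assumes fin: "finite (- resolvent_set T)" and poles: "\<And>\<zeta>. \<zeta> \<notin> resolvent_set T \<Longrightarrow> \<exists>n. spectral_pole T \<zeta> n"
  shows "\<exists>as. \<forall>x. shift_prod T as x = 0"
proof -
  obtain n where n: "\<And>a. a \<notin> resolvent_set T \<Longrightarrow> spectral_pole T a (n a)"
    using poles by metis
  obtain xs where xs: "set xs = - resolvent_set T" "distinct xs"
    using finite_distinct_list[OF fin] by blast
  define as where "as = concat (map (\<lambda>a. replicate (n a + 2) a) xs)"
  define q where "q w = (\<Prod>a \<in> - resolvent_set T. (w - a) ^ (n a + 2))" for w
  have q: "prod_list (map (\<lambda>a. w - a) as) = q w" for w
  proof -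
    have "prod_list (map (\<lambda>a. w - a) (concat (map (\<lambda>a. replicate (n a + 2) a) ys))) =
        prod_list (map (\<lambda>a. (w - a) ^ (n a + 2)) ys)" for ys
      by (induction ys) (simp_all add: mult.assoc)
    then show ?thesis
      unfolding as_def q_def xs(1)[symmetric] by (simp add: prod.distinct_set_conv_list[OF xs(2)])
  qed
  have holq: "q holomorphic_on S" for S
    unfolding q_def by (intro holomorphic_intros)
  show ?thesis
  proof (intro exI[of _ as] allI)
    fix x
    define y where "y = shift_prod T as x"
    have zero: "blinfun_apply f (resolvent T w y) = 0" if f: "f \<in> complex_dual" and w: "w \<in> resolvent_set T" for f w
    proof -
      text \<open>The exponent \<open>n a + 2\<close> leaves a double zero at \<open>a\<close>, so that extension by \<open>0\<close> is
        complex differentiable there.\<close>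
      define E where "E w = (if w \<in> resolvent_set T then q w * blinfun_apply f (resolvent T w x) else 0)" for w
      have "E field_differentiable at a" for a
      proof (cases "a \<in> resolvent_set T")
        case True
        have "(\<lambda>w. q w * blinfun_apply f (resolvent T w x)) holomorphic_on resolvent_set T"
          by (intro holomorphic_intros holq holomorphic_on_resolvent[OF f]) auto
        then have "E holomorphic_on resolvent_set T"
          by (rule holomorphic_transform) (auto simp: E_def)
        then show ?thesis
          using True open_resolvent_set holomorphic_on_imp_differentiable_at by blast
      next
        case False
        obtain r K where rK: "r > 0" "K > 0" "\<And>w. w \<in> ball a r - {a} \<Longrightarrow> w \<in> resolvent_set T"
          "\<And>w x. w \<in> ball a r - {a} \<Longrightarrow> cmod (w - a) ^ n a * norm (resolvent T w x) \<le> K * norm x"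
          using n[OF False] unfolding spectral_pole_def by blast
        define q' where "q' w = (\<Prod>b \<in> - resolvent_set T - {a}. (w - b) ^ (n b + 2))" for w
        have qq': "q w = (w - a) ^ (n a + 2) * q' w" for w
          unfolding q_def q'_def using fin False by (intro prod.remove) auto
        have "continuous_on (cball a r) q'"
          unfolding q'_def by (intro continuous_intros)
        then have "bounded (q' ` cball a r)"
          by (intro compact_imp_bounded compact_continuous_image compact_cball)
        then obtain M where M: "M > 0" "\<And>w. w \<in> cball a r \<Longrightarrow> cmod (q' w) \<le> M"
          unfolding bounded_pos by blast
        have "(E has_field_derivative 0) (at a)"
        proof (rule has_field_derivative_0_if_quadratic[OF rK(1), where C = "M * (norm f * (K * norm x))"])
          show "E a = 0"
            using False by (simp add: E_def)
          fix w assume w: "w \<in> ball a r"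
          show "cmod (E w) \<le> M * (norm f * (K * norm x)) * (cmod (w - a))\<^sup>2"
          proof (cases "w = a")
            case True
            then show ?thesis using False by (simp add: E_def)
          next
            case wa: False
            let ?R = "resolvent T w x"
            have "cmod (w - a) ^ n a * cmod (blinfun_apply f ?R) \<le> cmod (w - a) ^ n a * (norm f * norm ?R)"
              by (intro mult_left_mono norm_blinfun) simp
            also have "\<dots> = norm f * (cmod (w - a) ^ n a * norm ?R)"
              by simp
            also have "\<dots> \<le> norm f * (K * norm x)"
              using w wa by (intro mult_left_mono rK(4)) auto
            finally have "cmod (w - a) ^ n a * cmod (blinfun_apply f ?R) \<le> norm f * (K * norm x)" .
            then have "cmod (q' w) * (cmod (w - a) ^ n a * cmod (blinfun_apply f ?R)) \<le> M * (norm f * (K * norm x))"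
              using mult_mono[OF M(2)[of w]] M(1) w by simp
            then have "cmod (q' w) * (cmod (w - a) ^ n a * cmod (blinfun_apply f ?R)) * (cmod (w - a))\<^sup>2
                \<le> M * (norm f * (K * norm x)) * (cmod (w - a))\<^sup>2"
              by (rule mult_right_mono) simp
            then show ?thesis
              using rK(3) w wa by (simp add: E_def qq' norm_mult norm_power power_add power2_eq_square mult_ac)
          qed
        qed
        then show ?thesis
          unfolding field_differentiable_def by blast
      qed
      then have holE: "E holomorphic_on UNIV"
        by (intro holomorphic_onI) (simp add: field_differentiable_at_within)
      obtain p where p: "p holomorphic_on UNIV" "\<And>w. w \<in> resolvent_set T \<Longrightarrow>
          blinfun_apply f (resolvent T w y) = q w * blinfun_apply f (resolvent T w x) + p w"
        using resolvent_shift_prod[OF f, of as x] unfolding q y_def by blast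
      \<comment> \<open>The entire extension of the resolvent functional of \<open>y\<close> across
        the spectrum.\<close>
      define G where "G w = E w + p w" for w
      have G: "blinfun_apply f (resolvent T w y) = G w" if "w \<in> resolvent_set T" for w
        using p(2)[OF that] that by (simp add: G_def E_def)
      have "(G \<longlongrightarrow> 0) at_infinity"
      proof (rule Lim_null_comparison)
        show "eventually (\<lambda>w. norm (G w) \<le> norm f * norm y * 2 * cmod (inverse w)) at_infinity"
          unfolding eventually_at_infinity
        \<comment> \<open>Beyond \<open>2 * norm T\<close> the resolvent bound is at most
          \<open>2 / cmod w\<close>; the added 1 keeps \<open>w\<close> away from 0 when
          \<open>T\<close> is 0.\<close>
        proof (intro exI[of _ "2 * norm T + 1"] allI impI)
          fix w :: complex assume w: "2 * norm T + 1 \<le> norm w"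
          then have T_w: "norm T < cmod w" "0 < cmod w" and half: "cmod w / 2 \<le> cmod w - norm T"
            using norm_ge_zero[of T] by linarith+
          have "1 / (cmod w - norm T) \<le> 1 / (cmod w / 2)"
            using T_w by (intro divide_left_mono half mult_pos_pos) linarith+
          then have big: "norm T < cmod w" "1 / (cmod w - norm T) \<le> 2 / cmod w"
            using T_w by simp_all
          have b: "resolvent_bound T w (1 / (cmod w - norm T))"
            by (rule resolvent_bound_outside[OF big(1)])
          then have "w \<in> resolvent_set T"
            by (auto simp: resolvent_set_def)
          then have "norm (G w) \<le> norm f * norm (resolvent T w y)"
            using G norm_blinfun by metis
          also have "\<dots> \<le> norm f * (1 / (cmod w - norm T) * norm y)"
            using b by (intro mult_left_mono) (auto simp: resolvent_bound_def)
          also have "\<dots> \<le> norm f * (2 / cmod w * norm y)"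
            using big by (intro mult_left_mono mult_right_mono) auto
          finally show "norm (G w) \<le> norm f * norm y * 2 * cmod (inverse w)"
            by (simp add: norm_inverse divide_inverse mult_ac)
        qed
        show "((\<lambda>w. norm f * norm y * 2 * cmod (inverse w)) \<longlongrightarrow> 0) at_infinity"
          by (intro tendsto_mult_right_zero tendsto_norm_zero tendsto_inverse_0)
      qed
      moreover have "G holomorphic_on UNIV"
        unfolding G_def by (intro holomorphic_intros holE p)
      ultimately show ?thesis
        using G[OF w] Liouville_weak[of G 0 w] by simp
    qed
    obtain w where w: "w \<in> resolvent_set T"
      using resolvent_set_nonempty by blast
    obtain f where "f \<in> complex_dual" "norm (resolvent T w y) \<le> cmod (blinfun_apply f (resolvent T w y))"
      by (rule almost_norming_functional)
    then have "resolvent T w y = 0"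
      using zero[OF _ w] by simp
    then show "shift_prod T as x = 0"
      using resolvent_right[OF w, of y] by (simp add: y_def)
  qed
qed

end

section \<open>Infinitely many solutions for some small pair, or an infinite-dimensional
  eigenspace\<close>

theorem theorem1p1:
  fixes T :: "'a::complex_banach \<Rightarrow>\<^sub>L 'a"
  assumes "infinite_cdim (UNIV :: 'a set)"
    and "T \<in> bounded_operators"
  shows "\<forall>\<epsilon>::real. \<epsilon> > 0 \<longrightarrow>
    (\<exists>F \<in> bounded_operators. rank_at_most 1 F \<and> norm F \<le> \<epsilon> \<and>
      (\<exists>Y. half_space Y \<and> blinfun_apply (T + F) ` Y \<subseteq> Y))"
proof (intro allI impI)
  fix \<epsilon> :: real assume \<epsilon>: "\<epsilon> > 0"
  note T = assms(2)
  \<comment> \<open>The norm of the rank-one operator is at most \<open>norm f * norm e\<close>,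
    hence at most \<open>s * s\<close>.\<close>
  define s where "s = sqrt \<epsilon>"
  have s: "s > 0" "s * s = \<epsilon>"
    using \<epsilon> by (auto simp: s_def)
  define sols where "sols e f = {\<zeta> \<in> resolvent_set T. blinfun_apply f (resolvent T \<zeta> e) = 1}" for e :: 'a and f :: "'a \<Rightarrow>\<^sub>L complex"
  show "\<exists>F \<in> bounded_operators. rank_at_most 1 F \<and> norm F \<le> \<epsilon> \<and>
      (\<exists>Y. half_space Y \<and> blinfun_apply (T + F) ` Y \<subseteq> Y)"
  proof (cases "\<exists>e f. norm e \<le> s \<and> norm f \<le> s \<and> f \<in> complex_dual \<and> infinite (sols e f)")
    case True
    then obtain e f where ef: "norm e \<le> s" "norm f \<le> s" "f \<in> complex_dual" "infinite (sols e f)"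
      by blast
    have "norm f * norm e \<le> \<epsilon>"
      unfolding s(2)[symmetric] using ef s by (intro mult_mono) auto
    then show ?thesis
      using invariant_half_space_rank_one[OF T ef(3) ef(4)[unfolded sols_def]] by (meson order_trans)
  next
    case False
    then have fin: "\<And>e f. norm e \<le> s \<Longrightarrow> norm f \<le> s \<Longrightarrow> f \<in> complex_dual \<Longrightarrow>
        finite {\<zeta> \<in> resolvent_set T. blinfun_apply f (resolvent T \<zeta> e) = 1}"
      unfolding sols_def by blast
    have pole: "\<exists>n. spectral_pole T \<zeta> n" if \<zeta>: "\<zeta> \<in> closure (resolvent_set T)" "\<zeta> \<notin> resolvent_set T" for \<zeta>
    proof -
      obtain e0 f0 \<delta> r where nf: "f0 \<in> complex_dual" "\<delta> > 0" "r > 0"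
        and none: "\<And>e f w. norm (e - e0) \<le> \<delta> \<Longrightarrow> norm (f - f0) \<le> \<delta> \<Longrightarrow> f \<in> complex_dual \<Longrightarrow>
          w \<in> resolvent_set T \<inter> ball \<zeta> r \<Longrightarrow> blinfun_apply f (resolvent T w e) \<noteq> 1"
        by (rule no_solutions_near[OF T s(1) \<zeta>(2) fin]) blast+
      show ?thesis
        unfolding spectral_pole_def by (rule resolvent_pole_if_no_solution[OF T nf \<zeta>(2,1)]) (rule none)
    qed
    \<comment> \<open>Poles at the boundary points make the resolvent set dense, so every spectral
      point is a boundary point.\<close>
    have "\<exists>n. spectral_pole T \<zeta> n" if "\<zeta> \<notin> resolvent_set T" for \<zeta>
      using pole that finite_spectrum_if_poles(2)[OF T pole] by simp
    then obtain as where "\<forall>x. shift_prod T as x = 0"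
      using algebraic_if_poles[OF T finite_spectrum_if_poles(1)[OF T pole]] by blast
    then obtain a where a: "infinite_cdim {x. blinfun_apply T x = a *\<^sub>C x}"
      using infinite_eigenspace[OF T assms(1)] by blast
    let ?Z = "{x. blinfun_apply T x = a *\<^sub>C x}"
    have "csubspace ?Z"
      unfolding complex_vector.subspace_def
      by (auto simp: blinfun.add_right clinear_scaleC[OF clinear_T[OF T]] scaleC_add_right scaleC_scaleC mult.commute)
    moreover have "closed ?Z"
    proof (intro closed_Collect_eq continuous_intros linear_continuous_on)
      show "bounded_linear (scaleC a :: 'a \<Rightarrow> 'a)"
        by (rule bounded_linear_intro[where K = "cmod a"])
          (simp_all add: scaleC_add_right scaleR_eq_scaleC scaleC_scaleC mult.commute)
    qed
    ultimately obtain Y where Y: "half_space Y" "Y \<subseteq> ?Z"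
      using half_space_subset a by blast
    have "csubspace Y"
      using Y by (simp add: half_space_def)
    \<comment> \<open>\<open>T\<close> acts as a scalar on \<open>Y\<close>, so the zero
      perturbation suffices in this case.\<close>
    then have "blinfun_apply (T + 0) ` Y \<subseteq> Y"
      using Y(2) complex_vector.subspace_scale by (fastforce simp: blinfun.add_left)
    moreover have "0 \<in> (bounded_operators :: ('a \<Rightarrow>\<^sub>L 'a) set)"
      unfolding bounded_operators_def mem_Collect_eq by (rule clinearI) simp_all
    moreover have "rank_at_most 1 (0 :: 'a \<Rightarrow>\<^sub>L 'a)"
    proof -
      have "range (blinfun_apply (0 :: 'a \<Rightarrow>\<^sub>L 'a)) = cspan {}"
        by auto
      moreover have "cdim (cspan {} :: 'a set) \<le> card ({} :: 'a set)"
        by (intro complex_vector.dim_le_card) auto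
      ultimately show ?thesis
        unfolding rank_at_most_def finite_cdim_def by auto
    qed
    ultimately show ?thesis
      using Y(1) \<epsilon> by (intro bexI[of _ 0]) auto
  qed
qed

end
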